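(* Let $p$ be a prime and let $A \subseteq \mathbb{Z}_p \setminus \{0\}$ be a subset with $|A| = k \leq 10$. Then there is an ordering $(a_1,\ldots,a_k)$ of the elements of $A$ whose partial sums satisfy $s_i \neq s_j$ for all $1 \leq i < j \leq k$. In particular, this holds for every such $A$ which in addition contains no pair $\{x,-x\}$ and whose elements sum to $0$.
   Context: For an ordering $(a_1,\ldots,a_k)$ of the elements of a subset $A$ of an abelian group with $|A|=k$, the partial sums are $s_0 = 0$ and $s_j = \sum_{i=1}^j a_i$ for $1 \leq j \leq k$. $\mathbb{Z}_p$ denotes the integers modulo $p$. *)

theory Defs
  imports "HOL-Number_Theory.Residues"
begin

text \<open>An ordering \<open>(a\<^sub>1, \<dots>, a\<^sub>k)\<close> of a finite set is a function on \<open>nat\<close> of which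
  only the values at the indices \<open>1, \<dots>, k\<close> matter.\<close>

definition ordering_of :: "nat \<Rightarrow> (nat \<Rightarrow> 'a) \<Rightarrow> 'a set \<Rightarrow> bool" where
  "ordering_of k a A \<longleftrightarrow> bij_betw a {1..k} A"

definition partial_sum :: "('a, 'b) ring_scheme \<Rightarrow> (nat \<Rightarrow> 'a) \<Rightarrow> nat \<Rightarrow> 'a" where
  "partial_sum G a j = finsum G a {1..j}"

text \<open>The partial sum with index \<open>0\<close> (always zero) is not part of the distinctness
  requirement, so a later partial sum may vanish.\<close>

definition distinct_partial_sums :: "('a, 'b) ring_scheme \<Rightarrow> nat \<Rightarrow> (nat \<Rightarrow> 'a) \<Rightarrow> bool" where
  "distinct_partial_sums G k a \<longleftrightarrow>
     (\<forall>i j. 1 \<le> i \<and> i < j \<and> j \<le> k \<longrightarrow> partial_sum G a i \<noteq> partial_sum G a j)"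

end

theory Submission
  imports Defs "HOL-Computational_Algebra.Polynomial"
begin

text \<open>
  Put \<open>n = k - 1\<close>. It suffices to find \<open>n\<close> distinct elements \<open>x\<^sub>1, \<dots>, x\<^sub>n\<close> of \<open>A\<close> such that no
  block of consecutive ones has sum zero: put the remaining element of \<open>A\<close> in front. Let \<open>y\<^sub>0, \<dots>, y\<^sub>n\<close> be the
  partial sums, shifted so that \<open>y\<^sub>m = 0\<close> for some \<open>m\<close> in the middle. The product of the Vandermonde
  determinant in the \<open>x\<^sub>i\<close> and the determinant with exponents \<open>1, \<dots>, n\<close> in the \<open>y\<^sub>i\<close>, \<open>i \<noteq> m\<close>, is a
  homogeneous polynomial of degree \<open>n\<^sup>2\<close>, and a point of \<open>(A \<union> {0})\<^sup>n\<close> at which it does not vanish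
  modulo \<open>p\<close> gives such elements. By the
  Combinatorial Nullstellensatz, it is enough that the coefficient of some monomial
  \<open>x\<^sub>1 ^ d\<^sub>1 * \<dots> * x\<^sub>n ^ d\<^sub>n\<close> of degree \<open>n\<^sup>2\<close> with all \<open>d\<^sub>i \<le> k\<close> is not divisible by \<open>p\<close>. Expanding both
  determinants and eliminating the variables from the two ends of the chain towards the middle, each
  step contributes a single binomial coefficient, so the coefficient is computed by dynamic
  programming over the sets of exponents not yet used in the two determinants.
\<close>

section \<open>Alternants\<close>

text \<open>For \<open>xs\<close> with as many entries as \<open>S\<close>, the Laplace expansion
  along the first row of the determinant with entries \<open>x ^ s\<close>; the sign comes from the
  rank of \<open>s\<close> in \<open>S\<close>.\<close>

primrec alternant :: "nat set \<Rightarrow> 'a::comm_ring_1 list \<Rightarrow> 'a" where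
  "alternant S [] = 1"
| "alternant S (x # xs) =
     (\<Sum>s\<in>S. (-1) ^ card {u\<in>S. u < s} * x ^ s * alternant (S - {s}) xs)"

lemma alternant_of_int: "alternant S (map of_int xs) = of_int (alternant S xs)"
  by (induction xs arbitrary: S) simp_all

text \<open>Only the rank of the larger exponent depends on which of the two is removed first, and
  it changes by one.\<close>

lemma sign_pair:
  fixes S :: "nat set"
  assumes "finite S" "s \<in> S" "t \<in> S" "s \<noteq> t"
  shows "(-1::'a::comm_ring_1) ^ card {u\<in>S. u < s} * (-1) ^ card {u\<in>S - {s}. u < t} =
    - ((-1) ^ card {u\<in>S. u < t} * (-1) ^ card {u\<in>S - {t}. u < s})"
proof -
  have *: "(-1::'a) ^ card {u\<in>S. u < s} * (-1) ^ card {u\<in>S - {s}. u < t} =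
    - ((-1) ^ card {u\<in>S. u < t} * (-1) ^ card {u\<in>S - {t}. u < s})"
    if "s < t" "s \<in> S" for s t
  proof -
    have "{u\<in>S. u < t} = insert s {u\<in>S - {s}. u < t}" "{u\<in>S - {t}. u < s} = {u\<in>S. u < s}"
      using that by auto
    then show ?thesis using \<open>finite S\<close> by simp
  qed
  show ?thesis
  proof (cases "s < t")
    case True
    then show ?thesis using * assms by simp
  next
    case False
    then show ?thesis using *[of t s] assms by simp
  qed
qed

lemma alternant_swap:
  assumes "finite S"
  shows "alternant S (x # y # zs) = - alternant S (y # x # zs)"
proof -
  have expand: "alternant S (x # y # zs) = (\<Sum>(s,t)\<in>{(s,t). s \<in> S \<and> t \<in> S \<and> s \<noteq> t}.
      (-1) ^ card {u\<in>S. u < s} * (-1) ^ card {u\<in>S - {s}. u < t} * (x ^ s * y ^ t) *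
      alternant (S - {s} - {t}) zs)" for x y :: 'a
  proof -
    have "alternant S (x # y # zs) = (\<Sum>s\<in>S. \<Sum>t\<in>S - {s}.
      (-1) ^ card {u\<in>S. u < s} * (-1) ^ card {u\<in>S - {s}. u < t} * (x ^ s * y ^ t) *
      alternant (S - {s} - {t}) zs)"
      by (simp add: sum_distrib_left mult_ac)
    also have "\<dots> = (\<Sum>(s,t)\<in>Sigma S (\<lambda>s. S - {s}).
      (-1) ^ card {u\<in>S. u < s} * (-1) ^ card {u\<in>S - {s}. u < t} * (x ^ s * y ^ t) *
      alternant (S - {s} - {t}) zs)"
      using assms by (simp add: sum.Sigma)
    also have "Sigma S (\<lambda>s. S - {s}) = {(s,t). s \<in> S \<and> t \<in> S \<and> s \<noteq> t}"
      by auto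
    finally show ?thesis .
  qed
  have "alternant S (x # y # zs) = (\<Sum>(t,s)\<in>{(s,t). s \<in> S \<and> t \<in> S \<and> s \<noteq> t}.
      (-1) ^ card {u\<in>S. u < s} * (-1) ^ card {u\<in>S - {s}. u < t} * (x ^ s * y ^ t) *
      alternant (S - {s} - {t}) zs)"
    unfolding expand by (rule sum.reindex_bij_witness[of _ prod.swap prod.swap]) auto
  also have "\<dots> = (\<Sum>(t,s)\<in>{(s,t). s \<in> S \<and> t \<in> S \<and> s \<noteq> t}.
      - ((-1) ^ card {u\<in>S. u < t} * (-1) ^ card {u\<in>S - {t}. u < s} * (y ^ t * x ^ s) *
      alternant (S - {t} - {s}) zs))"
  proof (rule sum.cong[OF refl], clarify)
    fix t s assume st: "t \<in> S" "s \<in> S" "t \<noteq> s"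
    have "S - {s} - {t} = S - {t} - {s}" by auto
    then show "(-1) ^ card {u\<in>S. u < s} * (-1) ^ card {u\<in>S - {s}. u < t} * (x ^ s * y ^ t) *
      alternant (S - {s} - {t}) zs = - ((-1) ^ card {u\<in>S. u < t} * (-1) ^ card {u\<in>S - {t}. u < s} * (y ^ t * x ^ s) *
      alternant (S - {t} - {s}) zs)"
      using arg_cong[OF sign_pair[OF assms, of s t, where 'a = 'a],
          of "\<lambda>z. z * (x ^ s * y ^ t) * alternant (S - {s} - {t}) zs"] st
      by (simp add: mult_ac del: Diff_iff mem_Collect_eq)
  qed
  also have "\<dots> = - alternant S (y # x # zs)"
    unfolding expand by (simp add: sum_negf case_prod_unfold)
  finally show ?thesis .
qed

text \<open>Swaps carry the repeated entry next to the head, where the alternant equals its own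
  negative and, over the integers, is zero.\<close>

lemma alternant_head_repeated:
  fixes xs :: "int list"
  shows "finite S \<Longrightarrow> x \<in> set xs \<Longrightarrow> alternant S (x # xs) = 0"
proof (induction xs arbitrary: S)
  case (Cons y xs)
  show ?case
  proof (cases "x = y")
    case True
    have "alternant S (x # x # xs) = 0"
      using alternant_swap[OF Cons.prems(1), of x x xs] by linarith
    then show ?thesis using True by simp
  next
    case False
    then have "alternant S (y # x # xs) = 0"
      using Cons by (simp del: alternant.simps(2) add: alternant.simps(2)[of _ y])
    then show ?thesis using alternant_swap[OF Cons.prems(1), of x y xs] by simp
  qed
qed simp

lemma alternant_not_distinct:
  fixes xs :: "int list"
  shows "finite S \<Longrightarrow> \<not> distinct xs \<Longrightarrow> alternant S xs = 0"
proof (induction xs arbitrary: S)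
  case (Cons x xs)
  show ?case
  proof (cases "x \<in> set xs")
    case True
    then show ?thesis using alternant_head_repeated Cons.prems by blast
  next
    case False
    then show ?thesis using Cons by simp
  qed
qed simp

lemma alternant_zero_mem:
  "0 \<notin> S \<Longrightarrow> 0 \<in> set xs \<Longrightarrow> alternant S xs = 0"
  by (induction xs arbitrary: S) (auto simp: power_0_left intro!: sum.neutral)

lemma alternant_cong:
  fixes f :: "int \<Rightarrow> int"
  assumes "\<And>x. [f x = x] (mod m)"
  shows "[alternant S (map f xs) = alternant S xs] (mod m)"
  by (induction xs arbitrary: S) (auto intro!: cong_sum cong_mult cong_pow assms)

section \<open>Summation over a grid\<close>

text \<open>Lagrange interpolation weight: the reciprocal of the derivative at \<open>a\<close> of
  the monic polynomial with simple roots \<open>B\<close>.\<close>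

definition node_weight :: "'a::field set \<Rightarrow> 'a \<Rightarrow> 'a" where
  "node_weight B a = inverse (\<Prod>b\<in>B - {a}. a - b)"

text \<open>The functional of the coefficient formula behind the Combinatorial Nullstellensatz: for
  a polynomial whose degree is at most the sum of the \<open>card B - 1\<close>, it gives the
  coefficient of the monomial with these exponents.\<close>

primrec grid_sum :: "'a::field set list \<Rightarrow> ('a list \<Rightarrow> 'a) \<Rightarrow> 'a" where
  "grid_sum [] f = f []"
| "grid_sum (B # Bs) f = (\<Sum>a\<in>B. node_weight B a * grid_sum Bs (\<lambda>xs. f (a # xs)))"

lemma grid_sum_add: "grid_sum Bs (\<lambda>xs. f xs + g xs) = grid_sum Bs f + grid_sum Bs g"
  by (induction Bs arbitrary: f g) (simp_all add: distrib_left sum.distrib)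

lemma grid_sum_0: "grid_sum Bs (\<lambda>xs. 0) = 0"
  by (induction Bs) simp_all

lemma grid_sum_sum: "finite I \<Longrightarrow> grid_sum Bs (\<lambda>xs. \<Sum>i\<in>I. f i xs) = (\<Sum>i\<in>I. grid_sum Bs (f i))"
  by (induction I rule: finite_induct) (simp_all add: grid_sum_add grid_sum_0)

lemma grid_sum_cmult: "grid_sum Bs (\<lambda>xs. c * f xs) = c * grid_sum Bs f"
  by (induction Bs arbitrary: f) (simp_all add: sum_distrib_left mult_ac)

lemma grid_sum_cong:
  "(\<And>xs. length xs = length Bs \<Longrightarrow> f xs = g xs) \<Longrightarrow> grid_sum Bs f = grid_sum Bs g"
proof (induction Bs arbitrary: f g)
  case (Cons B Bs)
  have "grid_sum Bs (\<lambda>xs. f (a # xs)) = grid_sum Bs (\<lambda>xs. g (a # xs))" for a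
    by (rule Cons.IH) (simp add: Cons.prems)
  then show ?case by simp
qed simp

lemma grid_sum_append: "grid_sum (Bs @ Bs') f = grid_sum Bs (\<lambda>xs. grid_sum Bs' (\<lambda>ys. f (xs @ ys)))"
  by (induction Bs arbitrary: f) simp_all

text \<open>Lagrange interpolation on \<open>B\<close> reproduces \<open>q\<close>, and the products
  \<open>?L a\<close> are monic of degree \<open>card B - 1\<close>; compare coefficients
  there.\<close>

lemma node_sum_poly:
  fixes B :: "'a::field_char_0 set"
  assumes "finite B" "degree q < card B"
  shows "(\<Sum>a\<in>B. node_weight B a * poly q a) = coeff q (card B - 1)"
proof -
  let ?L = "\<lambda>a. \<Prod>b\<in>B - {a}. [:- b, 1:]"
  have deg: "degree (?L a) = card B - 1" and lead: "coeff (?L a) (card B - 1) = 1" if "a \<in> B" for a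
  proof -
    show d: "degree (?L a) = card B - 1"
      using that assms(1) by (subst degree_prod_eq_sum_degree) auto
    have "lead_coeff (?L a) = 1" by (simp add: lead_coeff_prod)
    then show "coeff (?L a) (card B - 1) = 1" using d by simp
  qed
  let ?p = "\<Sum>a\<in>B. smult (node_weight B a * poly q a) (?L a)"
  have "?p = q"
  proof (rule poly_eqI_degree)
    fix x assume x: "x \<in> B"
    have "poly ?p x = (\<Sum>a\<in>B. if a = x then poly q x else 0)"
      unfolding poly_sum
    proof (rule sum.cong[OF refl])
      fix a assume a: "a \<in> B"
      have "(\<Prod>b\<in>B - {x}. x - b) \<noteq> 0" using assms(1) by auto
      moreover have "(\<Prod>b\<in>B - {a}. x - b) = 0" if "a \<noteq> x"
        using assms(1) x that by auto
      ultimately show "poly (smult (node_weight B a * poly q a) (?L a)) x = (if a = x then poly q x else 0)"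
        by (auto simp: poly_prod node_weight_def)
    qed
    also have "\<dots> = poly q x" using x assms(1) by simp
    finally show "poly ?p x = poly q x" .
  next
    have "degree ?p \<le> card B - 1"
      by (rule degree_sum_le) (use assms(1) deg in \<open>auto intro: order_trans[OF degree_smult_le]\<close>)
    then show "degree ?p < card B" using assms by linarith
  qed (use assms in simp)
  then have "coeff q (card B - 1) = coeff ?p (card B - 1)" by simp
  also have "\<dots> = (\<Sum>a\<in>B. node_weight B a * poly q a)"
    unfolding coeff_sum by (rule sum.cong) (simp_all only: lead coeff_smult mult_1_right)
  finally show ?thesis by simp
qed

lemma node_sum_power:
  fixes B :: "'a::field_char_0 set"
  assumes "finite B" "card B = Suc d" "m \<le> d"
  shows "(\<Sum>a\<in>B. node_weight B a * a ^ m) = (if m = d then 1 else 0)"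
  using node_sum_poly[of B "monom 1 m"] assms by (simp add: poly_monom degree_monom_eq)

text \<open>Expand \<open>q\<close> at \<open>x + y\<close> in powers of \<open>y\<close>. The
  coefficient of \<open>y ^ k\<close> combines the weighted power sums over \<open>B\<close> of
  orders \<open>s + i - k\<close>, which vanish below order \<open>d\<close>. At
  \<open>k = a + s - d\<close> only \<open>i = a\<close> survives, with power sum 1. Lower
  coefficients may depend on \<open>B\<close>, so only the degree bound and the top coefficient are
  recorded.\<close>

lemma node_sum_shift:
  fixes q :: "'a::field_char_0 poly"
  assumes B: "finite B" "card B = Suc d" and q: "degree q \<le> a"
  obtains r where
    "\<And>y. (\<Sum>x\<in>B. node_weight B x * (x ^ s * poly q (x + y))) = poly r y"
    "a + s < d \<Longrightarrow> r = 0"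
    "d \<le> a + s \<Longrightarrow> degree r \<le> a + s - d"
    "d \<le> a + s \<Longrightarrow> coeff r (a + s - d) = coeff q a * (if s \<le> d then of_nat (a choose (d - s)) else 0)"
proof -
  let ?h = "\<lambda>m. \<Sum>x\<in>B. node_weight B x * x ^ m"
  let ?c = "\<lambda>k. \<Sum>i\<le>a. if k \<le> i then coeff q i * of_nat (i choose k) * ?h (s + (i - k)) else 0"
  define r where "r = (\<Sum>k\<le>a. monom (?c k) k)"
  have coeff_r: "coeff r k = (if k \<le> a then ?c k else 0)" for k
    unfolding r_def by (simp add: coeff_sum if_distrib cong: if_cong)
  have h: "?h m = (if m = d then 1 else 0)" if "m \<le> d" for m
    using node_sum_power[OF B that] .
  have small: "coeff r k = 0" if "a + s < d + k" for k
  proof -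
    have "?c k = 0"
    proof (rule sum.neutral, clarify)
      fix i assume "i \<le> a"
      then show "(if k \<le> i then coeff q i * of_nat (i choose k) * ?h (s + (i - k)) else 0) = 0"
        using that by (cases "k \<le> i") (simp_all add: h)
    qed
    then show ?thesis by (simp add: coeff_r)
  qed
  show ?thesis
  proof (rule that[of r])
    fix y
    have pq: "poly q z = (\<Sum>i\<le>a. coeff q i * z ^ i)" for z
      unfolding poly_altdef
      by (rule sum.mono_neutral_left) (use q in \<open>auto simp: coeff_eq_0\<close>)
    have "(\<Sum>x\<in>B. node_weight B x * (x ^ s * poly q (x + y))) =
      (\<Sum>x\<in>B. \<Sum>i\<le>a. \<Sum>k\<le>i. coeff q i * of_nat (i choose k) * (node_weight B x * x ^ (s + (i - k))) * y ^ k)"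
      unfolding pq add.commute[of _ y] binomial_ring
      by (simp only: sum_distrib_left power_add mult_ac)
    also have "\<dots> = (\<Sum>i\<le>a. \<Sum>k\<le>i. coeff q i * of_nat (i choose k) * ?h (s + (i - k)) * y ^ k)"
      by (subst sum.swap, intro sum.cong refl, subst sum.swap, intro sum.cong refl)
         (simp add: sum_distrib_left sum_distrib_right)
    also have "\<dots> = (\<Sum>i\<le>a. \<Sum>k\<le>a. (if k \<le> i then coeff q i * of_nat (i choose k) * ?h (s + (i - k)) else 0) * y ^ k)"
    proof (rule sum.cong[OF refl])
      fix i assume "i \<in> {..a}"
      then have "{k. k \<le> a \<and> k \<le> i} = {..i}" by auto
      then show "(\<Sum>k\<le>i. coeff q i * of_nat (i choose k) * ?h (s + (i - k)) * y ^ k) =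
        (\<Sum>k\<le>a. (if k \<le> i then coeff q i * of_nat (i choose k) * ?h (s + (i - k)) else 0) * y ^ k)"
        by (intro sum.mono_neutral_cong_left) auto
    qed
    also have "\<dots> = poly r y"
      by (subst sum.swap) (simp add: r_def poly_sum poly_monom sum_distrib_right)
    finally show "(\<Sum>x\<in>B. node_weight B x * (x ^ s * poly q (x + y))) = poly r y" .
  next
    assume "a + s < d"
    then show "r = 0" using small by (intro poly_eqI) simp
  next
    assume "d \<le> a + s"
    then show "degree r \<le> a + s - d" using small by (intro degree_le) auto
    let ?k = "a + s - d"
    show "coeff r ?k = coeff q a * (if s \<le> d then of_nat (a choose (d - s)) else 0)"
    \<comment> \<open>For \<open>d < s\<close> the index \<open>a + s - d\<close> exceeds
      \<open>a\<close>, where \<open>r\<close> has no coefficient.\<close>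
    proof (cases "s \<le> d")
      case True
      have "?c ?k = (\<Sum>i\<in>{a}. coeff q i * of_nat (i choose ?k))"
      proof (rule sum.mono_neutral_cong_right)
        show "\<forall>i\<in>{..a} - {a}. (if ?k \<le> i then coeff q i * of_nat (i choose ?k) * ?h (s + (i - ?k)) else 0) = 0"
          using True \<open>d \<le> a + s\<close> by (auto simp: h split: if_splits)
      qed (use True \<open>d \<le> a + s\<close> in \<open>auto simp: h\<close>)
      also have "\<dots> = coeff q a * of_nat (a choose (d - s))"
        using True \<open>d \<le> a + s\<close> binomial_symmetric[of "d - s" a] by (simp add: add.commute)
      finally show ?thesis using True \<open>d \<le> a + s\<close> by (simp add: coeff_r)
    qed (simp add: coeff_r)
  qed
qed

section \<open>Eliminating the variables of a chain\<close>

fun suffix_sums :: "'a::monoid_add list \<Rightarrow> 'a list" where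
  "suffix_sums [] = []"
| "suffix_sums (x # xs) = sum_list (x # xs) # suffix_sums xs"

lemma length_suffix_sums [simp]: "length (suffix_sums xs) = length xs"
  by (induction xs) auto

definition sgn_below :: "nat set \<Rightarrow> nat \<Rightarrow> int" where
  "sgn_below S s = (-1) ^ card {u\<in>S. u < s}"

text \<open>
  The lists below describe one half of the chain of summands, its outermost variable first, so that
  the partial sums (measured from the middle of the chain) are the suffix sums \<open>y\<close> of the list \<open>x\<close>.
  Then \<open>chain_coeff \<epsilon> K ds S T a\<close> is the coefficient of the monomial with exponents \<open>ds\<close> in
  \<open>alternant S x * alternant T (\<epsilon> * y) * (\<Sum>x) ^ a\<close>, where \<open>K\<close> accounts for the exponents in \<open>S\<close> and \<open>T\<close>
  that are left for the other half: extracting \<open>x\<^sub>1 ^ d\<close> from \<open>x\<^sub>1 ^ s * (x\<^sub>1 + Y) ^ (a + t)\<close> leaves a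
  multiple of \<open>Y ^ (a + t + s - d)\<close>, where \<open>Y\<close> is the sum of the remaining variables.
\<close>

primrec chain_coeff ::
    "int \<Rightarrow> (nat set \<Rightarrow> nat set \<Rightarrow> int) \<Rightarrow> nat list \<Rightarrow> nat set \<Rightarrow> nat set \<Rightarrow> nat \<Rightarrow> int" where
  "chain_coeff \<epsilon> K [] S T a = (if a = 0 then K S T else 0)"
| "chain_coeff \<epsilon> K (d # ds) S T a = (\<Sum>s\<in>S. \<Sum>t\<in>T.
     if s \<le> d \<and> d \<le> a + t + s
     then sgn_below S s * sgn_below T t * \<epsilon> ^ t * int (a + t choose (d - s)) *
       chain_coeff \<epsilon> K ds (S - {s}) (T - {t}) (a + t + s - d)
     else 0)"

text \<open>Induction along the chain. The outermost variable enters only through a power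
  \<open>x ^ s\<close> and a polynomial in the total sum, so summing it out leaves a polynomial in
  the sum of the remaining variables, which becomes the new \<open>q\<close>. Terms of
  \<open>q\<close> below degree \<open>a\<close> cannot reach the degree of the monomial.
  \<open>K\<close> and \<open>D\<close> are the coefficient and the degree left to the other
  half.\<close>

lemma grid_sum_chain:
  fixes Bs :: "'a::field_char_0 set list" and \<epsilon> :: int
  assumes K: "\<And>S T. finite S \<Longrightarrow> finite T \<Longrightarrow> card S = n \<Longrightarrow> card T = n \<Longrightarrow> \<Sum>S + \<Sum>T \<le> D \<Longrightarrow>
      grid_sum Bs' (\<lambda>xs. alternant S xs * alternant T (Y xs)) =
        (if \<Sum>S + \<Sum>T = D then of_int (K S T) else 0)"
    and "list_all2 (\<lambda>B d. finite B \<and> card B = Suc d) Bs ds"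
    and "finite S" "finite T" "card S = length ds + n" "card T = length ds + n"
    and "degree q \<le> a"
    and "\<Sum>S + \<Sum>T + a \<le> sum_list ds + D"
  shows "grid_sum Bs (\<lambda>xs. poly q (sum_list xs) * grid_sum Bs' (\<lambda>zs.
      alternant S (xs @ zs) * alternant T (map ((*) (of_int \<epsilon>)) (suffix_sums xs) @ Y zs))) =
    (if \<Sum>S + \<Sum>T + a = sum_list ds + D then coeff q a * of_int (chain_coeff \<epsilon> K ds S T a) else 0)"
  using assms(2-)
proof (induction Bs ds arbitrary: S T q a rule: list_all2_induct)
  case Nil
  then have *: "\<Sum>S + \<Sum>T \<le> D" by simp
  show ?case
  proof (cases "a = 0")
    case True
    then show ?thesis using Nil K[OF _ _ _ _ *] by (simp add: poly_0_coeff_0)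
  next
    case False
    then have "\<Sum>S + \<Sum>T \<noteq> D" using Nil.prems by simp
    then show ?thesis using False Nil K[OF _ _ _ _ *] by simp
  qed
next
  case (Cons B Bs d ds)
  let ?e = "of_int \<epsilon> :: 'a"
  define R where "R = (\<lambda>S T xs. grid_sum Bs' (\<lambda>zs.
      alternant S (xs @ zs) * alternant T (map ((*) ?e) (suffix_sums xs) @ Y zs)))"
  define sg :: "nat set \<Rightarrow> nat \<Rightarrow> 'a" where "sg = (\<lambda>S s. (-1) ^ card {u\<in>S. u < s})"
  \<comment> \<open>The power of the total sum produced by the second alternant is absorbed into
    \<open>q\<close>.\<close>
  define qt where "qt = (\<lambda>t. monom 1 t * q)"
  have sg: "sg S s = of_int (sgn_below S s)" for S s by (simp add: sg_def sgn_below_def)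
  have B: "finite B" "card B = Suc d" using Cons.hyps by auto
  have R_Cons: "R S T (x # xs) =
      (\<Sum>s\<in>S. \<Sum>t\<in>T. sg S s * sg T t * ?e ^ t * x ^ s * (x + sum_list xs) ^ t * R (S - {s}) (T - {t}) xs)"
    for x xs
  proof -
    have "R S T (x # xs) = grid_sum Bs' (\<lambda>zs. \<Sum>s\<in>S. \<Sum>t\<in>T. (sg S s * sg T t * ?e ^ t * x ^ s * (x + sum_list xs) ^ t) *
      (alternant (S - {s}) (xs @ zs) * alternant (T - {t}) (map ((*) ?e) (suffix_sums xs) @ Y zs)))"
      unfolding R_def sg_def by (simp add: sum_product power_mult_distrib mult_ac)
    then show ?thesis
      using Cons.prems by (simp add: grid_sum_sum grid_sum_cmult R_def)
  qed
  have elim: "grid_sum Bs (\<lambda>xs. (\<Sum>x\<in>B. node_weight B x * (x ^ s * poly (qt t) (x + sum_list xs))) *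
        R (S - {s}) (T - {t}) xs) =
      (if \<Sum>S + \<Sum>T + a = sum_list (d # ds) + D then
         (if s \<le> d \<and> d \<le> a + t + s then coeff q a * of_nat (a + t choose (d - s)) *
            of_int (chain_coeff \<epsilon> K ds (S - {s}) (T - {t}) (a + t + s - d)) else 0) else 0)"
    if st: "s \<in> S" "t \<in> T" for s t
  proof -
    have deg: "degree (qt t) \<le> a + t"
      unfolding qt_def using Cons.prems(5) degree_mult_le[of "monom 1 t" q]
        degree_monom_le[of "1::'a" t] by linarith
    obtain r where r: "\<And>y. (\<Sum>x\<in>B. node_weight B x * (x ^ s * poly (qt t) (x + y))) = poly r y"
      "a + t + s < d \<Longrightarrow> r = 0"
      "d \<le> a + t + s \<Longrightarrow> degree r \<le> a + t + s - d"
      "d \<le> a + t + s \<Longrightarrow> coeff r (a + t + s - d) =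
        coeff (qt t) (a + t) * (if s \<le> d then of_nat (a + t choose (d - s)) else 0)"
      using node_sum_shift[OF B deg, of s] by blast
    have sums: "\<Sum>(S - {s}) + s = \<Sum>S" "\<Sum>(T - {t}) + t = \<Sum>T"
      using Cons.prems st by (simp_all add: sum.remove[of _ _ "\<lambda>x. x"])
    show ?thesis
    proof (cases "d \<le> a + t + s")
      case False
      then show ?thesis using r(2) unfolding r(1) by (simp add: grid_sum_0)
    next
      case True
      have "coeff (qt t) (a + t) = coeff q a"
        by (simp add: qt_def coeff_monom_mult)
      moreover have "grid_sum Bs (\<lambda>xs. poly r (sum_list xs) * R (S - {s}) (T - {t}) xs) =
        (if \<Sum>(S - {s}) + \<Sum>(T - {t}) + (a + t + s - d) = sum_list ds + D
         then coeff r (a + t + s - d) * of_int (chain_coeff \<epsilon> K ds (S - {s}) (T - {t}) (a + t + s - d)) else 0)"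
        unfolding R_def
        by (rule Cons.IH) (use Cons.prems st r(3)[OF True] True sums in auto)
      moreover have "\<Sum>(S - {s}) + \<Sum>(T - {t}) + (a + t + s - d) = sum_list ds + D \<longleftrightarrow>
          \<Sum>S + \<Sum>T + a = sum_list (d # ds) + D"
        using sums True by auto
      ultimately show ?thesis unfolding r(1) r(4)[OF True] using True by simp
    qed
  qed
  have "grid_sum (B # Bs) (\<lambda>xs. poly q (sum_list xs) * R S T xs) =
      (\<Sum>x\<in>B. grid_sum Bs (\<lambda>xs. node_weight B x * (poly q (x + sum_list xs) * R S T (x # xs))))"
    by (simp add: grid_sum_cmult)
  also have "\<dots> = grid_sum Bs (\<lambda>xs. \<Sum>x\<in>B. node_weight B x * (poly q (x + sum_list xs) * R S T (x # xs)))"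
    using B by (simp add: grid_sum_sum)
  also have "(\<lambda>xs. \<Sum>x\<in>B. node_weight B x * (poly q (x + sum_list xs) * R S T (x # xs))) =
      (\<lambda>xs. \<Sum>s\<in>S. \<Sum>t\<in>T. sg S s * sg T t * ?e ^ t *
        ((\<Sum>x\<in>B. node_weight B x * (x ^ s * poly (qt t) (x + sum_list xs))) * R (S - {s}) (T - {t}) xs))"
  proof
    fix xs
    have "(\<Sum>x\<in>B. node_weight B x * (poly q (x + sum_list xs) * R S T (x # xs))) =
      (\<Sum>x\<in>B. \<Sum>s\<in>S. \<Sum>t\<in>T. sg S s * sg T t * ?e ^ t *
        (node_weight B x * (x ^ s * poly (qt t) (x + sum_list xs)) * R (S - {s}) (T - {t}) xs))"
      unfolding R_Cons qt_def by (simp add: sum_distrib_left poly_monom mult_ac)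
    also have "\<dots> = (\<Sum>s\<in>S. \<Sum>t\<in>T. \<Sum>x\<in>B. sg S s * sg T t * ?e ^ t *
        (node_weight B x * (x ^ s * poly (qt t) (x + sum_list xs)) * R (S - {s}) (T - {t}) xs))"
      by (subst sum.swap, intro sum.cong refl, rule sum.swap)
    finally show "(\<Sum>x\<in>B. node_weight B x * (poly q (x + sum_list xs) * R S T (x # xs))) =
      (\<Sum>s\<in>S. \<Sum>t\<in>T. sg S s * sg T t * ?e ^ t *
        ((\<Sum>x\<in>B. node_weight B x * (x ^ s * poly (qt t) (x + sum_list xs))) * R (S - {s}) (T - {t}) xs))"
      by (simp add: sum_distrib_left sum_distrib_right)
  qed
  also have "grid_sum Bs \<dots> = (\<Sum>s\<in>S. \<Sum>t\<in>T. sg S s * sg T t * ?e ^ t *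
      grid_sum Bs (\<lambda>xs. (\<Sum>x\<in>B. node_weight B x * (x ^ s * poly (qt t) (x + sum_list xs))) *
        R (S - {s}) (T - {t}) xs))"
    using Cons.prems by (simp add: grid_sum_sum grid_sum_cmult)
  also have "\<dots> = (\<Sum>s\<in>S. \<Sum>t\<in>T. sg S s * sg T t * ?e ^ t *
      (if \<Sum>S + \<Sum>T + a = sum_list (d # ds) + D then
         (if s \<le> d \<and> d \<le> a + t + s then coeff q a * of_nat (a + t choose (d - s)) *
            of_int (chain_coeff \<epsilon> K ds (S - {s}) (T - {t}) (a + t + s - d)) else 0) else 0))"
    by (intro sum.cong refl) (simp only: elim)
  also have "\<dots> = (if \<Sum>S + \<Sum>T + a = sum_list (d # ds) + D
      then coeff q a * of_int (chain_coeff \<epsilon> K (d # ds) S T a) else 0)"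
    by (cases "\<Sum>S + \<Sum>T + a = sum_list (d # ds) + D")
       (auto simp: sum_distrib_left sg mult_ac intro!: sum.cong sum.neutral)
  finally show ?case by (simp only: R_def)
qed

section \<open>Reduction modulo a prime\<close>

text \<open>The rational \<open>r\<close> lies in the maximal ideal of the localization of the integers at \<open>p\<close>.\<close>

definition p_divisible :: "int \<Rightarrow> rat \<Rightarrow> bool" where
  "p_divisible p r \<longleftrightarrow> (\<exists>m n. \<not> p dvd n \<and> r * of_int n = of_int (p * m))"

lemma p_divisible_of_int:
  assumes "prime p"
  shows "p_divisible p (of_int N) \<longleftrightarrow> p dvd N"
proof
  assume "p_divisible p (of_int N)"
  then obtain m n where "\<not> p dvd n" "(of_int (N * n) :: rat) = of_int (p * m)"
    unfolding p_divisible_def by auto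
  then have "\<not> p dvd n" "p dvd N * n" by (simp_all only: of_int_eq_iff dvd_triv_left not_False_eq_True)
  then show "p dvd N" using prime_dvd_multD[OF assms, of N n] by blast
next
  assume "p dvd N"
  then obtain m where "N = p * m" ..
  then show "p_divisible p (of_int N)"
    unfolding p_divisible_def using assms by (intro exI[of _ m] exI[of _ 1]) (auto simp: not_prime_unit)
qed

lemma p_divisible_add:
  assumes "prime p" "p_divisible p r" "p_divisible p s"
  shows "p_divisible p (r + s)"
proof -
  obtain m n m' n' where r: "\<not> p dvd n" "r * of_int n = of_int (p * m)"
    and s: "\<not> p dvd n'" "s * of_int n' = of_int (p * m')"
    using assms unfolding p_divisible_def by auto
  have "(r + s) * of_int (n * n') = (r * of_int n) * of_int n' + (s * of_int n') * of_int n"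
    by (simp add: algebra_simps)
  also have "\<dots> = of_int (p * (m * n' + m' * n))"
    unfolding r s by (simp add: algebra_simps)
  finally show ?thesis
    unfolding p_divisible_def using r(1) s(1) assms(1) by (metis prime_dvd_multD)
qed

lemma p_divisible_sum:
  assumes "prime p" "\<And>i. i \<in> I \<Longrightarrow> p_divisible p (f i)"
  shows "p_divisible p (sum f I)"
proof (cases "finite I")
  case True
  then show ?thesis using assms(2)
    by (induction I rule: finite_induct)
       (use p_divisible_of_int[OF assms(1), of 0] p_divisible_add[OF assms(1)] in auto)
qed (use p_divisible_of_int[OF assms(1), of 0] in auto)

lemma p_divisible_inverse_mult:
  assumes "prime p" "\<not> p dvd k" "p_divisible p r"
  shows "p_divisible p (inverse (of_int k) * r)"
proof -
  obtain m n where r: "\<not> p dvd n" "r * of_int n = of_int (p * m)"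
    using assms unfolding p_divisible_def by auto
  have "k \<noteq> 0" using assms by auto
  then have "inverse (of_int k) * r * of_int (k * n) = r * of_int n" by simp
  then show ?thesis
    unfolding p_divisible_def using r assms(1,2) by (metis prime_dvd_multD)
qed

text \<open>Nodes incongruent modulo \<open>p\<close> have weights whose denominators are prime to
  \<open>p\<close>. Contrapositively, a grid sum outside the ideal exhibits a grid point at which
  \<open>f\<close> is outside it, so an identity over the rationals yields nonvanishing modulo
  \<open>p\<close>.\<close>

lemma p_divisible_grid_sum:
  assumes "prime p"
    and "\<forall>B\<in>set Bs. finite B \<and> (\<forall>a\<in>B. \<forall>b\<in>B. a \<noteq> b \<longrightarrow> \<not> p dvd a - b)"
    and "\<And>xs. list_all2 (\<in>) xs Bs \<Longrightarrow> p_divisible p (f (map of_int xs))"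
  shows "p_divisible p (grid_sum (map ((`) of_int) Bs) f)"
  using assms(2,3)
proof (induction Bs arbitrary: f)
  case Nil
  then show ?case using Nil(2)[of "[]"] by simp
next
  case (Cons B Bs)
  have inj: "inj_on (of_int :: int \<Rightarrow> rat) C" for C by (simp add: inj_on_def)
  have weight: "node_weight (of_int ` B) (of_int a :: rat) = inverse (of_int (\<Prod>b\<in>B - {a}. a - b))" for a
  proof -
    have "of_int ` B - {of_int a :: rat} = of_int ` (B - {a})" by auto
    then show ?thesis unfolding node_weight_def by (simp add: prod.reindex[OF inj])
  qed
  have "p_divisible p (node_weight (of_int ` B) (of_int a) *
      grid_sum (map ((`) of_int) Bs) (\<lambda>xs. f (of_int a # xs)))" if a: "a \<in> B" for a
    unfolding weight
  proof (rule p_divisible_inverse_mult[OF assms(1)])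
    show "\<not> p dvd (\<Prod>b\<in>B - {a}. a - b)"
      using Cons.prems(1) a assms(1) by (subst prime_dvd_prod_iff) auto
    show "p_divisible p (grid_sum (map ((`) of_int) Bs) (\<lambda>xs. f (of_int a # xs)))"
    proof (rule Cons.IH)
      fix xs assume "list_all2 (\<in>) xs Bs"
      then show "p_divisible p (f (of_int a # map of_int xs))"
        using Cons.prems(2)[of "a # xs"] a by simp
    qed (use Cons.prems in auto)
  qed
  then show ?case
    by (simp add: sum.reindex[OF inj] p_divisible_sum[OF assms(1)])
qed

text \<open>The left half has \<open>\<epsilon> = -1\<close> because its partial sums, measured from
  the middle, are the negated suffix sums. Exponents starting at 1 let the second determinant also
  detect a partial sum equal to the middle one.\<close>

definition two_sided_coeff :: "nat list \<Rightarrow> nat list \<Rightarrow> int" where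
  "two_sided_coeff ds es = (let n = length ds + length es in
     chain_coeff (-1) (\<lambda>S T. chain_coeff 1 (\<lambda>S T. 1) es S T 0) ds {..<n} {1..n} 0)"

lemma suffix_sums_of_int: "suffix_sums (map of_int xs) = (map of_int (suffix_sums xs) :: 'a::ring_1 list)"
proof (induction xs)
  case (Cons x xs)
  have "sum_list (map of_int xs) = (of_int (sum_list xs) :: 'a)" by (induction xs) simp_all
  then show ?case using Cons by simp
qed simp

text \<open>Each variable of exponent \<open>d\<close> ranges over \<open>d + 1\<close> elements of
  \<open>B\<close>. The grid sum of the product of the two alternants then equals the coefficient,
  so \<open>p\<close> cannot divide the product at every grid point.\<close>

lemma alternant_grid_point:
  fixes B :: "int set"
  assumes p: "prime p" and B: "finite B" "\<And>a b. a \<in> B \<Longrightarrow> b \<in> B \<Longrightarrow> a \<noteq> b \<Longrightarrow> \<not> p dvd a - b"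
    and small: "\<forall>d\<in>set (ds @ es). d < card B"
    and n: "n = length ds + length es" "sum_list ds + sum_list es = n ^ 2"
    and coeff: "\<not> p dvd two_sided_coeff ds es"
  obtains xs zs where "set xs \<subseteq> B" "set zs \<subseteq> B" "length xs = length ds" "length zs = length es"
    "\<not> p dvd alternant {..<n} (xs @ zs)"
    "\<not> p dvd alternant {1..n} (map uminus (suffix_sums xs) @ suffix_sums zs)"
proof -
  have "\<exists>C\<subseteq>B. card C = Suc d" if "d \<in> set (ds @ es)" for d
    using obtain_subset_with_card_n[of "Suc d" B] small that by (metis Suc_leI)
  then obtain C where C: "\<And>d. d \<in> set (ds @ es) \<Longrightarrow> C d \<subseteq> B \<and> card (C d) = Suc d" by metis
  define f where "f = (\<lambda>xs zs. alternant {..<n} (xs @ zs) *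
    alternant {1..n} (map ((*) (of_int (-1))) (suffix_sums xs) @ suffix_sums zs) :: rat)"
  define G :: "nat list \<Rightarrow> rat set list" where "G = (\<lambda>ds. map (\<lambda>d. of_int ` C d) ds)"
  have G: "list_all2 (\<lambda>B d. finite B \<and> card B = Suc d) (G ds') ds'" if "set ds' \<subseteq> set (ds @ es)" for ds'
  proof -
    have "finite (C d) \<and> card (of_int ` C d :: rat set) = Suc d" if "d \<in> set ds'" for d
      using that \<open>set ds' \<subseteq> _\<close> C[of d] B(1) finite_subset by (subst card_image) (auto simp: inj_on_def)
    then show ?thesis unfolding G_def by (auto simp: list_all2_map1 list_all2_same)
  qed
  \<comment> \<open>The degrees \<open>n (n - 1) / 2\<close> and \<open>n (n + 1) / 2\<close> of the
    alternants add up to the degree of the monomial.\<close>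
  have sums: "\<Sum>{..<n} + \<Sum>{1..n} = n ^ 2"
    by (induction n) (simp_all add: power2_eq_square)
  \<comment> \<open>Nothing follows the right half, so its elimination ends in degree 0 with
    constant 1; the result is then the \<open>K\<close> of the left half.\<close>
  have inner: "grid_sum (G es) (\<lambda>zs. alternant S zs * alternant T (suffix_sums zs)) =
      (if \<Sum>S + \<Sum>T = sum_list es then of_int (chain_coeff 1 (\<lambda>S T. 1) es S T 0) else 0)"
    if "finite S" "finite T" "card S = length es" "card T = length es" "\<Sum>S + \<Sum>T \<le> sum_list es" for S T
    using grid_sum_chain[of 0 0 "[]" "\<lambda>_. []" "\<lambda>S T. 1" "G es" es S T 1 0 1] that G[of es]
    by (simp add: map_idI)
  have "grid_sum (G ds) (\<lambda>xs. grid_sum (G es) (\<lambda>zs. f xs zs)) = of_int (two_sided_coeff ds es)"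
    unfolding f_def
    using grid_sum_chain[of "length es" "sum_list es" "G es" suffix_sums
        "\<lambda>S T. chain_coeff 1 (\<lambda>S T. 1) es S T 0" "G ds" ds "{..<n}" "{1..n}" 1 0 "-1"]
      inner G[of ds] n sums by (simp add: two_sided_coeff_def Let_def)
  moreover have "grid_sum (G ds) (\<lambda>xs. grid_sum (G es) (\<lambda>zs. f xs zs)) =
      grid_sum (G ds @ G es) (\<lambda>xs. f (take (length ds) xs) (drop (length ds) xs))"
    unfolding grid_sum_append by (intro grid_sum_cong) (simp add: G_def)
  ultimately have total: "grid_sum (map ((`) of_int) (map C ds @ map C es))
      (\<lambda>xs. f (take (length ds) xs) (drop (length ds) xs)) = of_int (two_sided_coeff ds es)"
    by (simp add: G_def comp_def)
  have "\<exists>ws. list_all2 (\<in>) ws (map C ds @ map C es) \<and>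
      \<not> p_divisible p (f (take (length ds) (map of_int ws)) (drop (length ds) (map of_int ws)))"
  proof (rule ccontr)
    assume "\<not> ?thesis"
    then have "p_divisible p (grid_sum (map ((`) of_int) (map C ds @ map C es))
      (\<lambda>xs. f (take (length ds) xs) (drop (length ds) xs)))"
    proof (intro p_divisible_grid_sum[OF p])
      show "\<forall>D\<in>set (map C ds @ map C es). finite D \<and> (\<forall>a\<in>D. \<forall>b\<in>D. a \<noteq> b \<longrightarrow> \<not> p dvd a - b)"
      proof
        fix D assume "D \<in> set (map C ds @ map C es)"
        then have "D \<subseteq> B" using C by auto
        then show "finite D \<and> (\<forall>a\<in>D. \<forall>b\<in>D. a \<noteq> b \<longrightarrow> \<not> p dvd a - b)"
          using B finite_subset[of D B] by blast
      qed
    qed blast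
    then show False using coeff by (simp only: total p_divisible_of_int[OF p])
  qed
  then obtain ws where ws: "list_all2 (\<in>) ws (map C ds @ map C es)"
      "\<not> p_divisible p (f (take (length ds) (map of_int ws)) (drop (length ds) (map of_int ws)))"
    by blast
  define xs where "xs = take (length ds) ws"
  define zs where "zs = drop (length ds) ws"
  have sub: "set ws \<subseteq> B"
  proof
    fix w assume "w \<in> set ws"
    then obtain i where "i < length ws" "w = ws ! i" by (auto simp: in_set_conv_nth)
    then have "w \<in> (map C ds @ map C es) ! i" "i < length (map C ds @ map C es)"
      using ws(1) by (auto simp: list_all2_conv_all_nth)
    then show "w \<in> B" using C nth_mem[of i "map C ds @ map C es"] by auto
  qed
  have len: "length ws = n" using ws(1) n by (simp add: list_all2_lengthD)
  have "f (map of_int xs) (map of_int zs) = of_int (alternant {..<n} (xs @ zs) *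
      alternant {1..n} (map uminus (suffix_sums xs) @ suffix_sums zs))"
  proof -
    have "map ((*) (of_int (-1))) (map of_int (suffix_sums xs)) @ map of_int (suffix_sums zs) =
      (map of_int (map uminus (suffix_sums xs) @ suffix_sums zs) :: rat list)" by simp
    then show ?thesis
      unfolding f_def suffix_sums_of_int by (metis alternant_of_int map_append of_int_mult)
  qed
  moreover have "\<not> p_divisible p (f (map of_int xs) (map of_int zs))"
    using ws(2) by (simp add: xs_def zs_def take_map drop_map)
  ultimately have "\<not> p dvd alternant {..<n} (xs @ zs) *
      alternant {1..n} (map uminus (suffix_sums xs) @ suffix_sums zs)"
    by (simp only: p_divisible_of_int[OF p] not_False_eq_True)
  then show ?thesis
    using that[of xs zs] sub len n set_take_subset[of _ ws] set_drop_subset[of _ ws]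
    by (fastforce simp: xs_def zs_def)
qed

section \<open>From a grid point to an ordering\<close>

lemma nth_suffix_sums: "i < length xs \<Longrightarrow> suffix_sums xs ! i = sum_list (drop i xs)"
  by (induction xs arbitrary: i) (auto simp: nth_Cons split: nat.splits)

text \<open>Both halves are listed outermost variable first, so the chain reads
  \<open>xs @ rev zs\<close>. Measured from its middle, prefix sums on the left are negated suffix
  sums of \<open>xs\<close>; those on the right are suffix sums of \<open>zs\<close>, in reverse
  order.\<close>

lemma prefix_sum_diff:
  fixes xs zs :: "int list"
  defines "u \<equiv> length xs" and "v \<equiv> length zs"
  assumes "i \<le> u + v" "i \<noteq> u"
  shows "sum_list (take i (xs @ rev zs)) - sum_list xs =
    (map uminus (suffix_sums xs) @ suffix_sums zs) ! (if i < u then i else u + (u + v - i))"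
proof (cases "i < u")
  case True
  have "sum_list xs = sum_list (take i xs) + sum_list (drop i xs)"
    by (metis append_take_drop_id sum_list_append)
  then show ?thesis using True by (simp add: u_def nth_append nth_suffix_sums)
next
  case False
  then have "u < i" using assms by simp
  have "take (i - u) (rev zs) = rev (drop (u + v - i) zs)"
    using \<open>u < i\<close> assms(3) by (simp add: take_rev v_def add.commute[of u])
  then have "sum_list (take i (xs @ rev zs)) = sum_list xs + sum_list (drop (u + v - i) zs)"
    using \<open>u < i\<close> by (simp add: u_def sum_list_rev)
  moreover have "suffix_sums zs ! (u + v - i) = sum_list (drop (u + v - i) zs)"
    using \<open>u < i\<close> assms(3) by (intro nth_suffix_sums) (auto simp: v_def)
  ultimately show ?thesis
    using False by (simp add: u_def nth_append)
qed

text \<open>Residues turn congruent entries into equal ones, to which the vanishing lemmas over the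
  integers apply.\<close>

lemma alternant_mod_dvd_iff:
  fixes p :: int
  shows "p dvd alternant S (map (\<lambda>x. x mod p) xs) \<longleftrightarrow> p dvd alternant S xs"
  by (rule cong_dvd_iff[OF alternant_cong]) simp

lemma distinct_mod_if_alternant:
  fixes p :: int
  assumes "finite S" "\<not> p dvd alternant S xs"
  shows "distinct (map (\<lambda>x. x mod p) xs)"
  using alternant_mod_dvd_iff[of p S xs] alternant_not_distinct[OF assms(1), of "map (\<lambda>x. x mod p) xs"]
    assms(2) by force

lemma nonzero_mod_if_alternant:
  fixes p :: int
  assumes "0 \<notin> S" "\<not> p dvd alternant S xs"
  shows "0 \<notin> set (map (\<lambda>x. x mod p) xs)"
  using alternant_mod_dvd_iff[of p S xs] alternant_zero_mem[OF assms(1), of "map (\<lambda>x. x mod p) xs"]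
    assms(2) by force

text \<open>Measured from the middle, the prefix sums are 0 and the arguments of the alternant. Its
  nonvanishing makes these arguments pairwise incongruent and, all exponents being positive,
  incongruent to 0.\<close>

lemma distinct_prefix_sums:
  fixes xs zs :: "int list"
  defines "n \<equiv> length xs + length zs"
  assumes "\<not> p dvd alternant {1..n} (map uminus (suffix_sums xs) @ suffix_sums zs)"
    and "i < j" "j \<le> n"
  shows "\<not> [sum_list (take i (xs @ rev zs)) = sum_list (take j (xs @ rev zs))] (mod p)"
proof
  let ?P = "\<lambda>i. sum_list (take i (xs @ rev zs))"
  let ?u = "length xs" and ?ys = "map uminus (suffix_sums xs) @ suffix_sums zs"
  let ?e = "\<lambda>i. if i < ?u then i else ?u + (?u + length zs - i)"
  assume "[?P i = ?P j] (mod p)"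
  then have eq: "(?P i - sum_list xs) mod p = (?P j - sum_list xs) mod p"
    unfolding cong_def by (metis mod_diff_left_eq)
  have dist: "distinct (map (\<lambda>x. x mod p) ?ys)"
    and nz: "0 \<notin> set (map (\<lambda>x. x mod p) ?ys)"
    using distinct_mod_if_alternant[OF _ assms(2)] nonzero_mod_if_alternant[OF _ assms(2)] by auto
  have P: "(?P m - sum_list xs) mod p = map (\<lambda>x. x mod p) ?ys ! ?e m" "?e m < length ?ys"
    if "m \<le> n" "m \<noteq> ?u" for m
  proof -
    show e: "?e m < length ?ys" using that by (auto simp: n_def)
    show "(?P m - sum_list xs) mod p = map (\<lambda>x. x mod p) ?ys ! ?e m"
      unfolding nth_map[OF e] using prefix_sum_diff[OF that(1)[unfolded n_def] that(2)] by presburger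
  qed
  have P0: "?P ?u - sum_list xs = 0" by simp
  have mem: "(?P m - sum_list xs) mod p \<in> set (map (\<lambda>x. x mod p) ?ys)" if "m \<le> n" "m \<noteq> ?u" for m
    using P[OF that] nth_mem[of "?e m" "map (\<lambda>x. x mod p) ?ys"] by (simp only: length_map)
  have "i \<le> n" using assms(3,4) by simp
  consider "i = ?u" | "j = ?u" | "i \<noteq> ?u" "j \<noteq> ?u" by blast
  then show False
  proof cases
    case 1
    then have "0 = (?P j - sum_list xs) mod p" using eq P0 by simp
    moreover have "j \<noteq> ?u" using 1 assms(3) by simp
    ultimately show ?thesis using nz mem[OF assms(4)] by simp
  next
    case 2
    then have "(?P i - sum_list xs) mod p = 0" using eq P0 by simp
    moreover have "i \<noteq> ?u" using 2 assms(3) by simp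
    ultimately show ?thesis using nz mem[OF \<open>i \<le> n\<close>] by simp
  next
    case 3
    have "map (\<lambda>x. x mod p) ?ys ! ?e i = map (\<lambda>x. x mod p) ?ys ! ?e j"
      using eq unfolding P(1)[OF \<open>i \<le> n\<close> 3(1)] P(1)[OF assms(4) 3(2)] .
    then have "?e i = ?e j"
      by (subst (asm) nth_eq_iff_index_eq[OF dist])
         (use P(2)[OF \<open>i \<le> n\<close> 3(1)] P(2)[OF assms(4) 3(2)] in \<open>simp_all only: length_map\<close>)
    then show ?thesis using 3 assms(3,4) by (auto simp: n_def split: if_splits)
  qed
qed

lemma exists_ordering:
  fixes p :: nat and A :: "int set"
  defines "Zp \<equiv> residue_ring (int p)"
  assumes p: "prime p" and A: "A \<subseteq> carrier Zp - {\<zero>\<^bsub>Zp\<^esub>}" "card A = Suc n"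
    and n: "n = length ds + length es" "sum_list ds + sum_list es = n ^ 2" "\<forall>d\<in>set (ds @ es). d \<le> Suc n"
    and coeff: "\<not> int p dvd two_sided_coeff ds es"
  shows "\<exists>a. ordering_of (Suc n) a A \<and> distinct_partial_sums Zp (Suc n) a"
proof -
  have "int p > 1" using prime_gt_1_nat[OF p] by simp
  then interpret residues "int p" Zp by (unfold_locales) (simp_all add: Zp_def)
  have range: "0 < x \<and> x < int p" if "x \<in> A" for x
    using A(1) that by (auto simp: res_carrier_eq res_zero_eq)
  have fin: "finite A" using A(2) card.infinite by fastforce
  have "0 \<notin> A" using range by auto
  have "\<not> int p dvd a - b" if "a \<in> insert 0 A" "b \<in> insert 0 A" "a \<noteq> b" for a b
  proof
    assume "int p dvd a - b"
    moreover have "0 \<le> a" "a < int p" "0 \<le> b" "b < int p"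
      using that range \<open>int p > 1\<close> by force+
    ultimately show False using \<open>a \<noteq> b\<close> by (metis mod_eq_dvd_iff mod_pos_pos_trivial)
  qed
  then obtain xs zs where xz: "set xs \<subseteq> insert 0 A" "set zs \<subseteq> insert 0 A" "length xs = length ds" "length zs = length es"
    "\<not> int p dvd alternant {..<n} (xs @ zs)"
    "\<not> int p dvd alternant {1..n} (map uminus (suffix_sums xs) @ suffix_sums zs)"
    using alternant_grid_point[of "int p" "insert 0 A" ds es n] fin \<open>0 \<notin> A\<close> p n coeff A(2)
    by (metis card_insert_disjoint finite_insert le_imp_less_Suc prime_int_nat_transfer prime_nat_int_transfer)
  define w where "w = xs @ rev zs"
  have len: "length w = n" using xz n by (simp add: w_def)
  have sums: "\<not> [sum_list (take i w) = sum_list (take j w)] (mod int p)" if "i < j" "j \<le> n" for i j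
    using distinct_prefix_sums[of "int p" xs zs i j] xz n(1) that by (simp add: w_def)
  \<comment> \<open>A zero entry would make two consecutive prefix sums equal.\<close>
  have "0 \<notin> set w"
  proof
    assume "0 \<in> set w"
    then obtain i where "i < n" "w ! i = 0" using len by (auto simp: in_set_conv_nth)
    then show False using sums[of i "Suc i"] len by (simp add: take_Suc_conv_app_nth)
  qed
  then have w: "set w \<subseteq> A" using xz by (auto simp: w_def)
  have "distinct w"
    using distinct_mod_if_alternant[OF _ xz(5)] distinct_map[of "\<lambda>x. x mod int p" "xs @ zs"] by (simp add: w_def)
  then have "card (set w) = n" using len distinct_card by fastforce
  then obtain c where c: "c \<in> A" "c \<notin> set w"
    using A(2) w by (metis n_not_Suc_n subset_antisym subsetI)
  define a where "a = (\<lambda>i. (c # w) ! (i - 1))"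
  have set: "set (c # w) = A"
    using c w A(2) \<open>card (set w) = n\<close> fin by (intro card_subset_eq) auto
  have "bij_betw (\<lambda>i. i - 1) {1..Suc n} {..<Suc n}"
    by (rule bij_betw_byWitness[of _ Suc]) auto
  moreover have "bij_betw ((!) (c # w)) {..<Suc n} A"
    by (rule bij_betw_nth) (use \<open>distinct w\<close> c len set in auto)
  ultimately have ord: "ordering_of (Suc n) a A"
    unfolding ordering_of_def a_def using bij_betw_trans by (fastforce simp: comp_def)
  have psum: "partial_sum Zp a j = (c + sum_list (take (j - 1) w)) mod int p" if "1 \<le> j" "j \<le> Suc n" for j
  proof -
    \<comment> \<open>The entries are standard representatives, so the ring sum becomes an integer
      sum reduced modulo \<open>p\<close>.\<close>
    have "a i mod int p = a i" if "i \<in> {1..j}" for i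
    proof -
      have "a i \<in> A" using ord that \<open>j \<le> Suc n\<close> unfolding ordering_of_def bij_betw_def by auto
      then show ?thesis using range by force
    qed
    then have "partial_sum Zp a j = finsum Zp (\<lambda>i. a i mod int p) {1..j}"
      unfolding partial_sum_def by (intro add.finprod_cong') auto
    also have "\<dots> = (\<Sum>i\<in>{1..j}. a i) mod int p" by (rule sum_cong) simp
    also have "(\<Sum>i\<in>{1..j}. a i) = (\<Sum>i<j. (c # w) ! i)"
      by (rule sum.reindex_bij_witness[of _ Suc "\<lambda>i. i - 1"]) (auto simp: a_def)
    also have "\<dots> = sum_list (take j (c # w))"
      using that len by (simp add: sum_list_sum_nth lessThan_atLeast0)
    also have "\<dots> = c + sum_list (take (j - 1) w)"
      using that by (cases j) auto
    finally show ?thesis .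
  qed
  have "distinct_partial_sums Zp (Suc n) a"
    unfolding distinct_partial_sums_def
  proof (intro allI impI)
    fix i j assume ij: "1 \<le> i \<and> i < j \<and> j \<le> Suc n"
    then have "i - 1 < j - 1" "j - 1 \<le> n" by auto
    from sums[OF this] show "partial_sum Zp a i \<noteq> partial_sum Zp a j"
      using psum[of i] psum[of j] ij by (simp add: cong_def[symmetric] cong_add_lcancel)
  qed
  with ord show ?thesis by blast
qed

section \<open>Tables of chain coefficients\<close>

text \<open>
  A table is a formal linear combination of triples \<open>(S, T, a)\<close>, stored as a binary trie: the path to a
  \<open>Layer\<close> spells the characteristic vector of \<open>S\<close> (exponents from 0 on), the path from there to an
  \<open>Entry a v\<close> that of \<open>T\<close> (exponents from 1 on), and \<open>v\<close> is the coefficient.  Since \<open>a\<close> is in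
  practice determined by \<open>S\<close> and \<open>T\<close>, entries with equal paths can be added; the constructor \<open>Both\<close> never
  arises in the computations and only spares an invariant.
\<close>

datatype table = Empty | Entry nat int | Node table table | Layer table | Both table table

fun node :: "table \<Rightarrow> table \<Rightarrow> table" where
  "node Empty Empty = Empty"
| "node x y = Node x y"

fun layer :: "table \<Rightarrow> table" where
  "layer Empty = Empty"
| "layer x = Layer x"

fun merge :: "table \<Rightarrow> table \<Rightarrow> table" where
  "merge Empty y = y"
| "merge x Empty = x"
| "merge (Entry a v) (Entry b w) = (if a = b then Entry a (v + w) else Both (Entry a v) (Entry b w))"
| "merge (Node x y) (Node x' y') = Node (merge x x') (merge y y')"
| "merge (Layer x) (Layer y) = Layer (merge x y)"
| "merge x y = Both x y"

text \<open>Here \<open>u = a + t\<close> and \<open>e = d - s\<close>, so \<open>e \<le> u\<close>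
  says \<open>d \<le> a + t + s\<close>, and \<open>u - e\<close> is the new value of
  \<open>a\<close>; \<open>h\<close> exceeds \<open>e\<close> by the sum of the remaining
  exponents.\<close>

definition entry_step :: "nat \<Rightarrow> nat \<Rightarrow> int \<Rightarrow> nat \<Rightarrow> int \<Rightarrow> table" where
  "entry_step e h c u v = (if e \<le> u \<and> u \<le> h then Entry (u - e) (c * int (u choose e) * v) else Empty)"

text \<open>
  In the functions below, \<open>c\<close> is the accumulated sign, \<open>e\<close> is \<open>d - s\<close> for the exponent \<open>s\<close> already removed
  from \<open>S\<close>, and \<open>h\<close> cuts off values of \<open>a\<close> too large to be consumed by the rest of the chain
  (lemma \<open>chain_coeff_eq_0\<close>).
\<close>

primrec take_t :: "nat \<Rightarrow> nat \<Rightarrow> nat \<Rightarrow> int \<Rightarrow> table \<Rightarrow> table" where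
  "take_t e h t c Empty = Empty"
| "take_t e h t c (Entry a v) = entry_step e h c (a + t) v"
| "take_t e h t c (Node x y) = node (take_t e h t c x) (take_t e h t c y)"
| "take_t e h t c (Layer x) = Empty"
| "take_t e h t c (Both x y) = merge (take_t e h t c x) (take_t e h t c y)"

text \<open>In a right branch \<open>t\<close> belongs to the set. Either it is removed, which moves
  the branch to the left, or a larger element is removed and passing \<open>t\<close> flips the
  sign. One factor \<open>\<epsilon>\<close> per position builds up
  \<open>\<epsilon> ^ t\<close>.\<close>

primrec remove_t :: "int \<Rightarrow> nat \<Rightarrow> nat \<Rightarrow> nat \<Rightarrow> int \<Rightarrow> table \<Rightarrow> table" where
  "remove_t \<epsilon> e h t c Empty = Empty"
| "remove_t \<epsilon> e h t c (Entry a v) = Empty"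
| "remove_t \<epsilon> e h t c (Node x y) =
     node (merge (remove_t \<epsilon> e h (Suc t) (c * \<epsilon>) x) (take_t e h t c y)) (remove_t \<epsilon> e h (Suc t) (- c * \<epsilon>) y)"
| "remove_t \<epsilon> e h t c (Layer x) = Empty"
| "remove_t \<epsilon> e h t c (Both x y) = merge (remove_t \<epsilon> e h t c x) (remove_t \<epsilon> e h t c y)"

primrec take_s :: "int \<Rightarrow> nat \<Rightarrow> nat \<Rightarrow> int \<Rightarrow> table \<Rightarrow> table" where
  "take_s \<epsilon> e h c Empty = Empty"
| "take_s \<epsilon> e h c (Entry a v) = Empty"
| "take_s \<epsilon> e h c (Node x y) = node (take_s \<epsilon> e h c x) (take_s \<epsilon> e h c y)"
| "take_s \<epsilon> e h c (Layer x) = layer (remove_t \<epsilon> e h 1 (c * \<epsilon>) x)"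
| "take_s \<epsilon> e h c (Both x y) = merge (take_s \<epsilon> e h c x) (take_s \<epsilon> e h c y)"

primrec remove_s :: "int \<Rightarrow> nat \<Rightarrow> nat \<Rightarrow> nat \<Rightarrow> int \<Rightarrow> table \<Rightarrow> table" where
  "remove_s \<epsilon> d m s c Empty = Empty"
| "remove_s \<epsilon> d m s c (Entry a v) = Empty"
| "remove_s \<epsilon> d m s c (Node x y) =
     node (merge (remove_s \<epsilon> d m (Suc s) c x) (if s \<le> d then take_s \<epsilon> (d - s) (d - s + m) c y else Empty))
       (remove_s \<epsilon> d m (Suc s) (- c) y)"
| "remove_s \<epsilon> d m s c (Layer x) = Empty"
| "remove_s \<epsilon> d m s c (Both x y) = merge (remove_s \<epsilon> d m s c x) (remove_s \<epsilon> d m s c y)"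

primrec restrict_zero :: "table \<Rightarrow> table" where
  "restrict_zero Empty = Empty"
| "restrict_zero (Entry a v) = (if a = 0 then Entry a v else Empty)"
| "restrict_zero (Node x y) = node (restrict_zero x) (restrict_zero y)"
| "restrict_zero (Layer x) = layer (restrict_zero x)"
| "restrict_zero (Both x y) = merge (restrict_zero x) (restrict_zero y)"

primrec run_chain :: "int \<Rightarrow> nat list \<Rightarrow> table \<Rightarrow> table" where
  "run_chain \<epsilon> [] tb = restrict_zero tb"
| "run_chain \<epsilon> (d # ds) tb = run_chain \<epsilon> ds (remove_s \<epsilon> d (sum_list ds) 0 1 tb)"

primrec total_t :: "table \<Rightarrow> int" where
  "total_t Empty = 0"
| "total_t (Entry a v) = v"
| "total_t (Node x y) = total_t x + total_t y"
| "total_t (Layer x) = 0"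
| "total_t (Both x y) = total_t x + total_t y"

primrec total_s :: "table \<Rightarrow> int" where
  "total_s Empty = 0"
| "total_s (Entry a v) = 0"
| "total_s (Node x y) = total_s x + total_s y"
| "total_s (Layer x) = total_t x"
| "total_s (Both x y) = total_s x + total_s y"

text \<open>The single triple \<open>({..<n}, {1..n}, 0)\<close> with coefficient 1: both paths turn
  right throughout.\<close>

definition full_table :: "nat \<Rightarrow> table" where
  "full_table n = (Node Empty ^^ n) (Layer ((Node Empty ^^ n) (Entry 0 1)))"

section \<open>Meaning of tables and correctness of their operations\<close>

primrec eval_t :: "(nat set \<Rightarrow> nat \<Rightarrow> int) \<Rightarrow> nat \<Rightarrow> nat set \<Rightarrow> table \<Rightarrow> int" where
  "eval_t G t T Empty = 0"
| "eval_t G t T (Entry a v) = v * G T a"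
| "eval_t G t T (Node x y) = eval_t G (Suc t) T x + eval_t G (Suc t) (insert t T) y"
| "eval_t G t T (Layer x) = 0"
| "eval_t G t T (Both x y) = eval_t G t T x + eval_t G t T y"

text \<open>A table acts as a linear functional, summing \<open>v * G S T a\<close> over its
  triples; \<open>s\<close> is the next position and \<open>S\<close> the part already read. Each
  table operation is shown to be dual to an operation on \<open>G\<close>.\<close>

primrec eval_s :: "(nat set \<Rightarrow> nat set \<Rightarrow> nat \<Rightarrow> int) \<Rightarrow> nat \<Rightarrow> nat set \<Rightarrow> table \<Rightarrow> int" where
  "eval_s G s S Empty = 0"
| "eval_s G s S (Entry a v) = 0"
| "eval_s G s S (Node x y) = eval_s G (Suc s) S x + eval_s G (Suc s) (insert s S) y"
| "eval_s G s S (Layer x) = eval_t (G S) 1 {} x"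
| "eval_s G s S (Both x y) = eval_s G s S x + eval_s G s S y"

lemma eval_t_node [simp]: "eval_t G t T (node x y) = eval_t G t T (Node x y)"
  by (cases "(x, y)" rule: node.cases) auto

lemma eval_s_node [simp]: "eval_s G s S (node x y) = eval_s G s S (Node x y)"
  by (cases "(x, y)" rule: node.cases) auto

lemma eval_s_layer [simp]: "eval_s G s S (layer x) = eval_s G s S (Layer x)"
  by (cases x) auto

lemma eval_t_layer [simp]: "eval_t G s S (layer x) = eval_t G s S (Layer x)"
  by (cases x) auto

lemma eval_t_merge [simp]: "eval_t G t T (merge x y) = eval_t G t T x + eval_t G t T y"
  by (induction x y arbitrary: t T rule: merge.induct) (auto simp: algebra_simps)

lemma eval_s_merge [simp]: "eval_s G s S (merge x y) = eval_s G s S x + eval_s G s S y"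
  by (induction x y arbitrary: s S rule: merge.induct) auto

lemma eval_t_cong:
  assumes "finite T" "T \<subseteq> {..<t}"
    and "\<And>V a. finite V \<Longrightarrow> V \<inter> {..<t} = T \<Longrightarrow> F V a = G V a"
  shows "eval_t F t T x = eval_t G t T x"
  using assms
proof (induction x arbitrary: t T)
  case (Node x y)
  have "eval_t F (Suc t) T x = eval_t G (Suc t) T x"
  proof (rule Node.IH(1))
    fix V a assume "finite V" "V \<inter> {..<Suc t} = T"
    moreover from this have "V \<inter> {..<t} = T" using Node.prems(2) by (auto simp: less_Suc_eq)
    ultimately show "F V a = G V a" using Node.prems(3) by blast
  qed (use Node.prems in auto)
  moreover have "eval_t F (Suc t) (insert t T) y = eval_t G (Suc t) (insert t T) y"
  proof (rule Node.IH(2))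
    fix V a assume "finite V" "V \<inter> {..<Suc t} = insert t T"
    moreover from this have "V \<inter> {..<t} = T" using Node.prems(2) by (auto simp: less_Suc_eq)
    ultimately show "F V a = G V a" using Node.prems(3) by blast
  qed (use Node.prems in auto)
  ultimately show ?case by simp
qed auto

lemma eval_s_cong:
  assumes "finite S" "S \<subseteq> {..<s}"
    and "\<And>V T a. finite V \<Longrightarrow> finite T \<Longrightarrow> 0 \<notin> T \<Longrightarrow> V \<inter> {..<s} = S \<Longrightarrow> F V T a = G V T a"
  shows "eval_s F s S x = eval_s G s S x"
  using assms
proof (induction x arbitrary: s S)
  case (Node x y)
  have "eval_s F (Suc s) S x = eval_s G (Suc s) S x"
  proof (rule Node.IH(1))
    fix V T :: "nat set" and a assume "finite V" "finite T" "0 \<notin> T" "V \<inter> {..<Suc s} = S"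
    moreover from this have "V \<inter> {..<s} = S" using Node.prems(2) by (auto simp: less_Suc_eq)
    ultimately show "F V T a = G V T a" using Node.prems(3) by blast
  qed (use Node.prems in auto)
  moreover have "eval_s F (Suc s) (insert s S) y = eval_s G (Suc s) (insert s S) y"
  proof (rule Node.IH(2))
    fix V T :: "nat set" and a assume "finite V" "finite T" "0 \<notin> T" "V \<inter> {..<Suc s} = insert s S"
    moreover from this have "V \<inter> {..<s} = S" using Node.prems(2) by (auto simp: less_Suc_eq)
    ultimately show "F V T a = G V T a" using Node.prems(3) by blast
  qed (use Node.prems in auto)
  ultimately show ?case by simp
next
  case (Layer x)
  have "eval_t (F S) 1 {} x = eval_t (G S) 1 {} x"
  proof (rule eval_t_cong)
    fix V :: "nat set" and a assume "finite V" "V \<inter> {..<1} = {}"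
    then show "F S V a = G S V a"
      by (intro Layer.prems(3)) (use Layer.prems in auto)
  qed auto
  then show ?case by simp
qed auto

lemma eval_t_0: "eval_t (\<lambda>V a. 0) t T x = 0"
  by (induction x arbitrary: t T) auto

lemma eval_s_0: "eval_s (\<lambda>V T a. 0) s S x = 0"
  by (induction x arbitrary: s S) (auto simp: eval_t_0)

lemma eval_t_add: "eval_t (\<lambda>V a. F V a + G V a) t T x = eval_t F t T x + eval_t G t T x"
  by (induction x arbitrary: t T) (auto simp: algebra_simps)

lemma eval_s_add: "eval_s (\<lambda>V T a. F V T a + G V T a) s S x = eval_s F s S x + eval_s G s S x"
  by (induction x arbitrary: s S) (auto simp: eval_t_add)

definition step_term :: "(nat set \<Rightarrow> nat \<Rightarrow> int) \<Rightarrow> nat \<Rightarrow> nat \<Rightarrow> nat \<Rightarrow> nat set \<Rightarrow> nat \<Rightarrow> int" where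
  "step_term G e h t T a = (if e \<le> a + t \<and> a + t \<le> h then int (a + t choose e) * G (T - {t}) (a + t - e) else 0)"

lemma eval_take_t:
  assumes "t < t'" "t \<notin> T"
  shows "eval_t G t' T (take_t e h t c x) = eval_t (\<lambda>V a. c * step_term G e h t V a) t' (insert t T) x"
  using assms
proof (induction x arbitrary: t' T)
  case (Node x y)
  have "t \<notin> insert t' T" "t < Suc t'" using Node.prems by auto
  then show ?case using Node.IH(1)[of "Suc t'" T] Node.IH(2)[of "Suc t'" "insert t' T"] Node.prems
    by (simp add: insert_commute)
qed (auto simp: entry_step_def step_term_def)

text \<open>When an element is reached, all smaller ones have been read, so the sign in
  \<open>c\<close> is exactly its \<open>sgn_below\<close>.\<close>

lemma eval_remove_t:
  assumes "finite T" "T \<subseteq> {..<t}" "c = (-1) ^ card T * \<epsilon> ^ t"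
  shows "eval_t G t T (remove_t \<epsilon> e h t c x) =
    eval_t (\<lambda>V a. \<Sum>v\<in>{v\<in>V. t \<le> v}. sgn_below V v * \<epsilon> ^ v * step_term G e h v V a) t T x"
  using assms
proof (induction x arbitrary: t T c)
  case (Node x y)
  let ?H = "\<lambda>t V a. \<Sum>v\<in>{v\<in>V. t \<le> v}. sgn_below V v * \<epsilon> ^ v * step_term G e h v V a"
  have "t \<notin> T" using Node.prems by auto
  have "eval_t G (Suc t) T (remove_t \<epsilon> e h (Suc t) (c * \<epsilon>) x) = eval_t (?H (Suc t)) (Suc t) T x"
    by (rule Node.IH(1)) (use Node.prems in auto)
  also have "\<dots> = eval_t (?H t) (Suc t) T x"
  proof (rule eval_t_cong)
    fix V a assume "V \<inter> {..<Suc t} = T"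
    then have "t \<notin> V" using \<open>t \<notin> T\<close> by auto
    then have "{v\<in>V. Suc t \<le> v} = {v\<in>V. t \<le> v}" by (metis Suc_leD Suc_leI le_neq_implies_less)
    then show "?H (Suc t) V a = ?H t V a" by simp
  qed (use Node.prems in auto)
  finally have 1: "eval_t G (Suc t) T (remove_t \<epsilon> e h (Suc t) (c * \<epsilon>) x) = eval_t (?H t) (Suc t) T x" .
  have 2: "eval_t G (Suc t) T (take_t e h t c y) =
      eval_t (\<lambda>V a. c * step_term G e h t V a) (Suc t) (insert t T) y"
    by (rule eval_take_t) (use \<open>t \<notin> T\<close> in auto)
  have 3: "eval_t G (Suc t) (insert t T) (remove_t \<epsilon> e h (Suc t) (- c * \<epsilon>) y) =
      eval_t (?H (Suc t)) (Suc t) (insert t T) y"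
    by (rule Node.IH(2)) (use Node.prems \<open>t \<notin> T\<close> in auto)
  have "eval_t (?H t) (Suc t) (insert t T) y =
      eval_t (\<lambda>V a. c * step_term G e h t V a + ?H (Suc t) V a) (Suc t) (insert t T) y"
  proof (rule eval_t_cong)
    fix V a assume V: "finite V" "V \<inter> {..<Suc t} = insert t T"
    then have "t \<in> V" by auto
    then have "{v\<in>V. t \<le> v} = insert t {v\<in>V. Suc t \<le> v}"
      by (auto simp: Suc_le_eq)
    moreover have "{u\<in>V. u < t} = T" using V Node.prems(2) by (auto simp: less_Suc_eq)
    ultimately show "?H t V a = c * step_term G e h t V a + ?H (Suc t) V a"
      using V Node.prems by (simp add: sgn_below_def)
  qed (use Node.prems in auto)
  then show ?case using 1 2 3 by (simp add: eval_t_add)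
next
  case (Entry a v)
  then have *: "{v\<in>T. t \<le> v} = {}" by auto
  show ?case unfolding eval_t.simps * by simp
qed auto

definition layer_term ::
    "int \<Rightarrow> (nat set \<Rightarrow> nat set \<Rightarrow> nat \<Rightarrow> int) \<Rightarrow> nat \<Rightarrow> nat \<Rightarrow> nat \<Rightarrow> nat set \<Rightarrow> nat set \<Rightarrow> nat \<Rightarrow> int" where
  "layer_term \<epsilon> G e h s S T a = (\<Sum>t\<in>T. sgn_below T t * \<epsilon> ^ t * step_term (G (S - {s})) e h t T a)"

lemma eval_take_s:
  assumes "s < s'" "s \<notin> S"
  shows "eval_s G s' S (take_s \<epsilon> e h c x) = eval_s (\<lambda>V T a. c * layer_term \<epsilon> G e h s V T a) s' (insert s S) x"
  using assms
proof (induction x arbitrary: s' S)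
  case (Node x y)
  have "s \<notin> insert s' S" "s < Suc s'" using Node.prems by auto
  then show ?case using Node.IH(1)[of "Suc s'" S] Node.IH(2)[of "Suc s'" "insert s' S"] Node.prems
    by (simp add: insert_commute)
next
  case (Layer x)
  \<comment> \<open>The sign from removing \<open>s\<close> factors out, so that
    \<open>eval_remove_t\<close> applies with its initial value \<open>\<epsilon>\<close>.\<close>
  have take: "eval_t G t T (take_t e h t' (c * c') x) = c * eval_t G t T (take_t e h t' c' x)" for G t T t' c' x
    by (induction x arbitrary: t T) (auto simp: entry_step_def algebra_simps)
  have scale: "eval_t G t T (remove_t \<epsilon> e h t' (c * c') x) = c * eval_t G t T (remove_t \<epsilon> e h t' c' x)"
    for G t T t' c'
  proof (induction x arbitrary: t T t' c')
    case (Node x y)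
    have "c * c' * \<epsilon> = c * (c' * \<epsilon>)" "- (c * c') * \<epsilon> = c * (- c' * \<epsilon>)" by simp_all
    then show ?case using Node by (simp only: remove_t.simps eval_t_node eval_t.simps eval_t_merge take distrib_left)
  qed (auto simp: algebra_simps)
  have "eval_t (G S) 1 {} (remove_t \<epsilon> e h 1 \<epsilon> x) = eval_t (layer_term \<epsilon> G e h s (insert s S)) 1 {} x"
  proof (subst eval_remove_t)
    have "insert s S - {s} = S" using Layer.prems by auto
    \<comment> \<open>The sets read off here do not contain 0, so \<open>1 \<le> v\<close> excludes
      nothing.\<close>
    then show "eval_t (\<lambda>V a. \<Sum>v\<in>{v\<in>V. 1 \<le> v}. sgn_below V v * \<epsilon> ^ v * step_term (G S) e h v V a) 1 {} x =
      eval_t (layer_term \<epsilon> G e h s (insert s S)) 1 {} x"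
      by (intro eval_t_cong) (auto simp: layer_term_def disjoint_iff Suc_le_eq intro!: sum.cong gr0I)
  qed auto
  moreover have "eval_t (\<lambda>T a. c * F T a) t T x = c * eval_t F t T x" for F t T
    by (induction x arbitrary: t T) (auto simp: algebra_simps)
  ultimately show ?case using scale[of "G S" 1 "{}" 1 \<epsilon>] by simp
qed auto

lemma eval_remove_s:
  assumes "finite S" "S \<subseteq> {..<s}" "c = (-1) ^ card S"
  shows "eval_s G s S (remove_s \<epsilon> d m s c x) =
    eval_s (\<lambda>V T a. \<Sum>v\<in>{v\<in>V. s \<le> v}. if v \<le> d then sgn_below V v * layer_term \<epsilon> G (d - v) (d - v + m) v V T a else 0) s S x"
  using assms
proof (induction x arbitrary: s S c)
  case (Node x y)
  let ?f = "\<lambda>v V T a. if v \<le> d then sgn_below V v * layer_term \<epsilon> G (d - v) (d - v + m) v V T a else 0"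
  let ?H = "\<lambda>s V T a. \<Sum>v\<in>{v\<in>V. s \<le> v}. ?f v V T a"
  have "s \<notin> S" using Node.prems by auto
  have "eval_s G (Suc s) S (remove_s \<epsilon> d m (Suc s) c x) = eval_s (?H (Suc s)) (Suc s) S x"
    by (rule Node.IH(1)) (use Node.prems in auto)
  also have "\<dots> = eval_s (?H s) (Suc s) S x"
  proof (rule eval_s_cong)
    fix V T a assume "V \<inter> {..<Suc s} = S"
    then have "s \<notin> V" using \<open>s \<notin> S\<close> by auto
    then have "{v\<in>V. Suc s \<le> v} = {v\<in>V. s \<le> v}" by (metis Suc_leD Suc_leI le_neq_implies_less)
    then show "?H (Suc s) V T a = ?H s V T a" by simp
  qed (use Node.prems in auto)
  finally have 1: "eval_s G (Suc s) S (remove_s \<epsilon> d m (Suc s) c x) = eval_s (?H s) (Suc s) S x" .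
  have 2: "eval_s G (Suc s) S (if s \<le> d then take_s \<epsilon> (d - s) (d - s + m) c y else Empty) =
      eval_s (\<lambda>V T a. if s \<le> d then c * layer_term \<epsilon> G (d - s) (d - s + m) s V T a else 0) (Suc s) (insert s S) y"
    using eval_take_s[of s "Suc s" S] \<open>s \<notin> S\<close> by (simp add: eval_s_0)
  have 3: "eval_s G (Suc s) (insert s S) (remove_s \<epsilon> d m (Suc s) (- c) y) =
      eval_s (?H (Suc s)) (Suc s) (insert s S) y"
    by (rule Node.IH(2)) (use Node.prems \<open>s \<notin> S\<close> in auto)
  have "eval_s (?H s) (Suc s) (insert s S) y =
      eval_s (\<lambda>V T a. (if s \<le> d then c * layer_term \<epsilon> G (d - s) (d - s + m) s V T a else 0) + ?H (Suc s) V T a)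
        (Suc s) (insert s S) y"
  proof (rule eval_s_cong)
    fix V T a assume V: "finite V" "V \<inter> {..<Suc s} = insert s S"
    then have "s \<in> V" by auto
    then have "{v\<in>V. s \<le> v} = insert s {v\<in>V. Suc s \<le> v}"
      by (auto simp: Suc_le_eq)
    moreover have "{u\<in>V. u < s} = S" using V Node.prems(2) by (auto simp: less_Suc_eq)
    ultimately show "?H s V T a = (if s \<le> d then c * layer_term \<epsilon> G (d - s) (d - s + m) s V T a else 0) + ?H (Suc s) V T a"
      using V Node.prems by (simp add: sgn_below_def)
  qed (use Node.prems in auto)
  then show ?case using 1 2 3 by (simp add: eval_s_add)
next
  case (Layer x)
  then have *: "{v\<in>S. s \<le> v} = {}" by auto
  show ?case unfolding eval_s.simps * by (simp add: eval_t_0)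
qed auto

text \<open>An exponent \<open>d\<close> lowers \<open>a\<close> by at most \<open>d\<close>, so
  \<open>a\<close> is still positive at the end of the chain, where only \<open>a = 0\<close>
  counts.\<close>

lemma chain_coeff_eq_0: "a > sum_list ds \<Longrightarrow> chain_coeff \<epsilon> K ds S T a = 0"
  by (induction ds arbitrary: S T a) (auto intro!: sum.neutral)

lemma eval_chain_step:
  "eval_s (chain_coeff \<epsilon> K (d # ds)) 0 {} tb =
    eval_s (chain_coeff \<epsilon> K ds) 0 {} (remove_s \<epsilon> d (sum_list ds) 0 1 tb)"
proof -
  have *: "chain_coeff \<epsilon> K (d # ds) S T a =
      (\<Sum>v\<in>{v\<in>S. 0 \<le> v}. if v \<le> d then sgn_below S v *
        layer_term \<epsilon> (chain_coeff \<epsilon> K ds) (d - v) (d - v + sum_list ds) v S T a else 0)" for S T a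
  proof -
    have "(\<Sum>t\<in>T. if v \<le> d \<and> d \<le> a + t + v
       then sgn_below S v * sgn_below T t * \<epsilon> ^ t * int (a + t choose (d - v)) *
         chain_coeff \<epsilon> K ds (S - {v}) (T - {t}) (a + t + v - d) else 0) =
      (if v \<le> d then sgn_below S v *
        layer_term \<epsilon> (chain_coeff \<epsilon> K ds) (d - v) (d - v + sum_list ds) v S T a else 0)" for v
    proof (cases "v \<le> d")
      case True
      then have "a + t + v - d = a + t - (d - v)" "d \<le> a + t + v \<longleftrightarrow> d - v \<le> a + t" for t by auto
      moreover have "chain_coeff \<epsilon> K ds (S - {v}) (T - {t}) (a + t - (d - v)) = 0"
        if "d - v + sum_list ds < a + t" for t
        by (rule chain_coeff_eq_0) (use that in simp)
      ultimately show ?thesis using True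
        by (auto simp: layer_term_def step_term_def sum_distrib_left not_le intro!: sum.cong)
    qed simp
    then show ?thesis by simp
  qed
  show ?thesis unfolding * by (rule eval_remove_s[symmetric]) auto
qed

lemma eval_t_restrict_zero: "eval_t G t T (restrict_zero x) = eval_t (\<lambda>T a. if a = 0 then G T 0 else 0) t T x"
  by (induction x arbitrary: t T) auto

lemma eval_s_restrict_zero:
  "eval_s G s S (restrict_zero x) = eval_s (\<lambda>S T a. if a = 0 then G S T 0 else 0) s S x"
  by (induction x arbitrary: s S) (auto simp: eval_t_restrict_zero)

lemma eval_run_chain:
  assumes "\<And>S T. G S T 0 = K S T"
  shows "eval_s (chain_coeff \<epsilon> K ds) 0 {} tb = eval_s G 0 {} (run_chain \<epsilon> ds tb)"
proof (induction ds arbitrary: tb)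
  case Nil
  have "chain_coeff \<epsilon> K [] = (\<lambda>S T a. if a = 0 then G S T 0 else 0)" using assms by (auto simp: fun_eq_iff)
  then show ?case by (simp only: eval_s_restrict_zero run_chain.simps)
next
  case (Cons d ds)
  then show ?case by (simp only: eval_chain_step run_chain.simps)
qed

lemma eval_full_table: "eval_s G 0 {} (full_table n) = G {..<n} {1..n} 0"
proof -
  have t: "eval_t F t T ((Node Empty ^^ n) (Entry 0 1)) = F (T \<union> {t..<t + n}) 0" for F t T n
  proof (induction n arbitrary: t T)
    case (Suc n)
    have "insert t T \<union> {Suc t..<Suc t + n} = T \<union> {t..<t + Suc n}" by auto
    then show ?case using Suc by (simp del: funpow.simps add: funpow.simps(2))
  qed simp
  have "eval_s G s S ((Node Empty ^^ k) (Layer ((Node Empty ^^ n) (Entry 0 1)))) = G (S \<union> {s..<s + k}) {1..n} 0" for s S k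
  proof (induction k arbitrary: s S)
    case (Suc k)
    have "insert s S \<union> {Suc s..<Suc s + k} = S \<union> {s..<s + Suc k}" by auto
    then show ?case using Suc by simp
  qed (simp add: t atLeastLessThanSuc_atLeastAtMost)
  then show ?thesis by (simp add: full_table_def lessThan_atLeast0)
qed

lemma eval_t_total: "eval_t (\<lambda>T a. 1) t T tb = total_t tb"
  by (induction tb arbitrary: t T) auto

lemma eval_s_total: "eval_s (\<lambda>S T a. 1) s S tb = total_s tb"
  by (induction tb arbitrary: s S) (auto simp: eval_t_total)

text \<open>By duality the nested recursion becomes two forward passes, in which equal states
  reached by different removals are merged; evaluation at the constant function 1 gives the
  total.\<close>

theorem two_sided_coeff_code:
  "two_sided_coeff ds es = total_s (run_chain 1 es (run_chain (-1) ds (full_table (length ds + length es))))"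
  unfolding two_sided_coeff_def Let_def eval_full_table[symmetric]
    eval_run_chain[of "chain_coeff 1 (\<lambda>S T. 1) es", OF refl]
    eval_run_chain[of "\<lambda>S T a. 1" "\<lambda>S T. 1", OF refl] eval_s_total ..

section \<open>Evaluation of the coefficients by rewriting\<close>

lemma choose_table:
  "int (2 choose 1) = 2" "int (3 choose 1) = 3" "int (3 choose 2) = 3" "int (4 choose 1) = 4"
  "int (4 choose 2) = 6" "int (4 choose 3) = 4" "int (5 choose 1) = 5" "int (5 choose 2) = 10"
  "int (5 choose 3) = 10" "int (5 choose 4) = 5" "int (6 choose 1) = 6" "int (6 choose 2) = 15"
  "int (6 choose 3) = 20" "int (6 choose 4) = 15" "int (6 choose 5) = 6" "int (7 choose 1) = 7"
  "int (7 choose 2) = 21" "int (7 choose 3) = 35" "int (7 choose 4) = 35" "int (7 choose 5) = 21"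
  "int (7 choose 6) = 7" "int (8 choose 1) = 8" "int (8 choose 2) = 28" "int (8 choose 3) = 56"
  "int (8 choose 4) = 70" "int (8 choose 5) = 56" "int (8 choose 6) = 28" "int (8 choose 7) = 8"
  "int (9 choose 1) = 9" "int (9 choose 2) = 36" "int (9 choose 3) = 84" "int (9 choose 4) = 126"
  "int (9 choose 5) = 126" "int (9 choose 6) = 84" "int (9 choose 7) = 36" "int (9 choose 8) = 9"
  "int (10 choose 1) = 10" "int (10 choose 2) = 45" "int (10 choose 3) = 120"
  "int (10 choose 4) = 210" "int (10 choose 5) = 252" "int (10 choose 6) = 210"
  "int (10 choose 7) = 120" "int (10 choose 8) = 45" "int (10 choose 9) = 10"
  "int (11 choose 1) = 11" "int (11 choose 2) = 55" "int (11 choose 3) = 165"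
  "int (11 choose 4) = 330" "int (11 choose 5) = 462" "int (11 choose 6) = 462"
  "int (11 choose 7) = 330" "int (11 choose 8) = 165" "int (11 choose 9) = 55"
  "int (11 choose 10) = 11" "int (12 choose 1) = 12" "int (12 choose 2) = 66"
  "int (12 choose 3) = 220" "int (12 choose 4) = 495" "int (12 choose 5) = 792"
  "int (12 choose 6) = 924" "int (12 choose 7) = 792" "int (12 choose 8) = 495"
  "int (12 choose 9) = 220" "int (12 choose 10) = 66" "int (13 choose 1) = 13"
  "int (13 choose 2) = 78" "int (13 choose 3) = 286" "int (13 choose 4) = 715"
  "int (13 choose 5) = 1287" "int (13 choose 6) = 1716" "int (13 choose 7) = 1716"
  "int (13 choose 8) = 1287" "int (13 choose 9) = 715" "int (13 choose 10) = 286"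
  "int (14 choose 1) = 14" "int (14 choose 2) = 91" "int (14 choose 3) = 364"
  "int (14 choose 4) = 1001" "int (14 choose 5) = 2002" "int (14 choose 6) = 3003"
  "int (14 choose 7) = 3432" "int (14 choose 8) = 3003" "int (14 choose 9) = 2002"
  "int (14 choose 10) = 1001" "int (15 choose 1) = 15" "int (15 choose 2) = 105"
  "int (15 choose 3) = 455" "int (15 choose 4) = 1365" "int (15 choose 5) = 3003"
  "int (15 choose 6) = 5005" "int (15 choose 7) = 6435" "int (15 choose 8) = 6435"
  "int (15 choose 9) = 5005" "int (15 choose 10) = 3003" "int (16 choose 1) = 16"
  "int (16 choose 2) = 120" "int (16 choose 3) = 560" "int (16 choose 4) = 1820"
  "int (16 choose 5) = 4368" "int (16 choose 6) = 8008" "int (16 choose 7) = 11440"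
  "int (16 choose 8) = 12870" "int (16 choose 9) = 11440" "int (16 choose 10) = 8008"
  "int (17 choose 1) = 17" "int (17 choose 2) = 136" "int (17 choose 3) = 680"
  "int (17 choose 4) = 2380" "int (17 choose 5) = 6188" "int (17 choose 6) = 12376"
  "int (17 choose 7) = 19448" "int (17 choose 8) = 24310" "int (17 choose 9) = 24310"
  "int (17 choose 10) = 19448" "int (18 choose 1) = 18" "int (18 choose 2) = 153"
  "int (18 choose 3) = 816" "int (18 choose 4) = 3060" "int (18 choose 5) = 8568"
  "int (18 choose 6) = 18564" "int (18 choose 7) = 31824" "int (18 choose 8) = 43758"
  "int (18 choose 9) = 48620" "int (18 choose 10) = 43758" "int (19 choose 1) = 19"
  "int (19 choose 2) = 171" "int (19 choose 3) = 969" "int (19 choose 4) = 3876"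
  "int (19 choose 5) = 11628" "int (19 choose 6) = 27132" "int (19 choose 7) = 50388"
  "int (19 choose 8) = 75582" "int (19 choose 9) = 92378" "int (19 choose 10) = 92378"
  by (simp_all add: binomial_fact' fact_numeral)

lemma numeral_minus_one_nat:
  "numeral (Num.Bit0 n) - (1::nat) = numeral (Num.BitM n)"
  "numeral (Num.Bit1 n) - (1::nat) = numeral (Num.Bit0 n)"
  "1 - numeral n = (0::nat)"
  by (simp_all only: pred_numeral_def[symmetric] pred_numeral_simps diff_is_0_eq one_le_numeral)

lemma funpow_numeral: "(f ^^ numeral k) x = f ((f ^^ (numeral k - 1)) x)"
  by (metis funpow.simps(2) comp_apply Suc_diff_1 zero_less_numeral)

lemma funpow_one: "((f :: table \<Rightarrow> table) ^^ 1) x = f x"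
  by simp

lemma Suc_0_eq_1: "Suc 0 = 1"
  by simp

lemmas table_eval =
  node.simps layer.simps merge.simps entry_step_def take_t.simps remove_t.simps take_s.simps
  remove_s.simps restrict_zero.simps run_chain.simps total_t.simps total_s.simps
  two_sided_coeff_code full_table_def funpow_0 funpow_numeral funpow_one
  sum_list.Cons sum_list.Nil list.size choose_table binomial_n_n binomial_n_0 of_nat_1

lemmas numeral_eval =
  Suc_0_eq_1 Suc_1 Suc_numeral add_0 add_0_right arith_simps numeral_plus_one one_plus_numeral
  one_add_one rel_simps if_True if_False simp_thms mult_1 mult_1_right minus_minus mult_minus1
  mult_minus1_right minus_zero add_numeral_special add_neg_numeral_special right_minus left_minus
  mult_zero_left mult_zero_right diff_nat_numeral diff_numeral_simps sub_num_simps
  diff_numeral_special nat_numeral nat_0 nat_1 numeral_minus_one_nat BitM.simps inc.simps numeral_One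
  diff_zero diff_self_eq_0 le_zero_eq le0

text \<open>
  The exponents were found by a computer search for coefficients whose common prime factors are all
  less than \<open>k = n + 1\<close>, where \<open>n\<close> is the number of exponents; for \<open>n = 8\<close> and \<open>n = 9\<close> two monomials are needed.
\<close>

lemma two_sided_coeff_upto_7:
  "two_sided_coeff [] [] = 1"
  "two_sided_coeff [] [1] = 1"
  "two_sided_coeff [] [3, 1] = 1"
  "two_sided_coeff [] [4, 4, 1] = 1"
  "two_sided_coeff [5, 5, 5] [1] = 1"
  "two_sided_coeff [6, 6] [6, 6, 1] = - 4"
  "two_sided_coeff [7, 7, 1] [7, 7, 7] = 20"
  "two_sided_coeff [8, 8, 8] [8, 5, 8, 4] = - 20250"
  \<comment> \<open>The weak congruence rule leaves the branches of a conditional unevaluated until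
    its condition is decided.\<close>
  by (simp_all only: table_eval numeral_eval cong: if_weak_cong)

lemma two_sided_coeff_8_left:
  "two_sided_coeff [9, 9, 1] [9, 9, 9, 9, 9] = 144324"
  by (simp only: table_eval numeral_eval cong: if_weak_cong)

lemma two_sided_coeff_8_right:
  "two_sided_coeff [9, 9, 9, 1] [9, 9, 9, 9] = - 314556"
  by (simp only: table_eval numeral_eval cong: if_weak_cong)

lemma two_sided_coeff_9_left:
  "two_sided_coeff [10, 10, 10, 1] [10, 10, 10, 10, 10] = 254703096"
  by (simp only: table_eval numeral_eval cong: if_weak_cong)

lemma two_sided_coeff_9_right:
  "two_sided_coeff [10, 10, 10, 10, 1] [10, 10, 10, 10] = - 326776260"
  by (simp only: table_eval numeral_eval cong: if_weak_cong)

lemmas two_sided_coeff_values = two_sided_coeff_upto_7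
  two_sided_coeff_8_left two_sided_coeff_8_right two_sided_coeff_9_left two_sided_coeff_9_right

section \<open>Choice of a monomial for each prime\<close>

lemma not_dvd_smooth:
  assumes "prime p" "5 < p"
  shows "\<not> int p dvd 2 ^ a * 3 ^ b * 5 ^ c"
proof -
  have "\<not> int p dvd q" if "0 < q" "q \<le> 5" for q
    using zdvd_imp_le[of "int p" q] that assms(2) by auto
  then have "\<not> int p dvd 2" "\<not> int p dvd 3" "\<not> int p dvd 5" by simp_all
  moreover have "prime (int p)" using assms(1) by simp
  ultimately show ?thesis
    using prime_dvd_power[of "int p"] by (metis prime_dvd_multD)
qed

lemma exists_two_sided_coeff:
  assumes "prime p" "Suc n < p" "n \<le> 9"
  shows "\<exists>ds es. n = length ds + length es \<and> sum_list ds + sum_list es = n ^ 2 \<and>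
    (\<forall>d\<in>set (ds @ es). d \<le> Suc n) \<and> \<not> int p dvd two_sided_coeff ds es"
proof -
  have one: "\<not> int p dvd 1" using assms(1) by (auto dest: prime_gt_1_nat)
  have "n = 0 \<or> n = 1 \<or> n = 2 \<or> n = 3 \<or> n = 4 \<or> n = 5 \<or> n = 6 \<or> n = 7 \<or> n = 8 \<or> n = 9"
    using assms(3) by presburger
  then consider "n = 0" | "n = 1" | "n = 2" | "n = 3" | "n = 4" | "n = 5" | "n = 6" | "n = 7" | "n = 8" | "n = 9"
    by blast
  then show ?thesis
  proof cases
    case 1
    show ?thesis
      by (rule exI[of _ "[]"], rule exI[of _ "[]"])
         (use 1 one two_sided_coeff_values in simp)
  next
    case 2
    show ?thesis
      by (rule exI[of _ "[]"], rule exI[of _ "[1]"])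
         (use 2 one two_sided_coeff_values in simp)
  next
    case 3
    show ?thesis
      by (rule exI[of _ "[]"], rule exI[of _ "[3, 1]"])
         (use 3 one two_sided_coeff_values in simp)
  next
    case 4
    show ?thesis
      by (rule exI[of _ "[]"], rule exI[of _ "[4, 4, 1]"])
         (use 4 one two_sided_coeff_values in simp)
  next
    case 5
    show ?thesis
      by (rule exI[of _ "[5, 5, 5]"], rule exI[of _ "[1]"])
         (use 5 one two_sided_coeff_values in simp)
  next
    case 6
    have "\<not> int p dvd 4" using not_dvd_smooth[OF assms(1), of 2 0 0] 6 assms(2) by simp
    then show ?thesis
      by (intro exI[of _ "[6, 6]"] exI[of _ "[6, 6, 1]"])
         (use 6 two_sided_coeff_values in simp)
  next
    case 7
    have "\<not> int p dvd 20" using not_dvd_smooth[OF assms(1), of 2 0 1] 7 assms(2) by simp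
    then show ?thesis
      by (intro exI[of _ "[7, 7, 1]"] exI[of _ "[7, 7, 7]"])
         (use 7 two_sided_coeff_values in simp)
  next
    case 8
    \<comment> \<open>\<open>20250 = 2 * 3 ^ 4 * 5 ^ 3\<close>, while \<open>p > 8\<close>.\<close>
    have "\<not> int p dvd 20250" using not_dvd_smooth[OF assms(1), of 1 4 3] 8 assms(2) by simp
    then show ?thesis
      by (intro exI[of _ "[8, 8, 8]"] exI[of _ "[8, 5, 8, 4]"])
         (use 8 two_sided_coeff_values in simp)
  next
    case 9
    have "\<not> int p dvd 12" using not_dvd_smooth[OF assms(1), of 2 1 0] 9 assms(2) by simp
    \<comment> \<open>A Bezout combination: the two coefficients have greatest common divisor 12, so
      \<open>p\<close> fails to divide one of them. The case of nine exponents is alike.\<close>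
    then have "\<not> int p dvd 10915 * 144324 + (-5008) * 314556" by simp
    then consider "\<not> int p dvd two_sided_coeff [9, 9, 9, 1] [9, 9, 9, 9]"
      | "\<not> int p dvd two_sided_coeff [9, 9, 1] [9, 9, 9, 9, 9]"
      unfolding two_sided_coeff_values by (metis dvd_add dvd_minus_iff dvd_mult)
    then show ?thesis
    proof cases
      case 1
      then show ?thesis by (intro exI[of _ "[9, 9, 9, 1]"] exI[of _ "[9, 9, 9, 9]"]) (use 9 in simp)
    next
      case 2
      then show ?thesis by (intro exI[of _ "[9, 9, 1]"] exI[of _ "[9, 9, 9, 9, 9]"]) (use 9 in simp)
    qed
  next
    case 10
    have "\<not> int p dvd 12" using not_dvd_smooth[OF assms(1), of 2 1 0] 10 assms(2) by simp
    then have "\<not> int p dvd 7866597 * 254703096 + (-6131555) * 326776260" by simp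
    then consider "\<not> int p dvd two_sided_coeff [10, 10, 10, 10, 1] [10, 10, 10, 10]"
      | "\<not> int p dvd two_sided_coeff [10, 10, 10, 1] [10, 10, 10, 10, 10]"
      unfolding two_sided_coeff_values by (metis dvd_add dvd_minus_iff dvd_mult)
    then show ?thesis
    proof cases
      case 1
      then show ?thesis
        by (intro exI[of _ "[10, 10, 10, 10, 1]"] exI[of _ "[10, 10, 10, 10]"]) (use 10 in simp)
    next
      case 2
      then show ?thesis
        by (intro exI[of _ "[10, 10, 10, 1]"] exI[of _ "[10, 10, 10, 10, 10]"]) (use 10 in simp)
    qed
  qed
qed

theorem theorem2p3:
  fixes p k :: nat and A :: "int set"
  defines "Zp \<equiv> residue_ring (int p)"
  assumes "prime p"
    and "A \<subseteq> carrier Zp - {\<zero>\<^bsub>Zp\<^esub>}"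
    and "card A = k" and "k \<le> 10"
  shows "(\<exists>a. ordering_of k a A \<and> distinct_partial_sums Zp k a) \<and>
    ((\<forall>x\<in>A. \<ominus>\<^bsub>Zp\<^esub> x \<notin> A) \<and> finsum Zp (\<lambda>x. x) A = \<zero>\<^bsub>Zp\<^esub> \<longrightarrow>
      (\<exists>a. ordering_of k a A \<and> distinct_partial_sums Zp k a))"
proof -
  have "A \<subseteq> {1..int p - 1}"
    using assms(3) unfolding Zp_def residue_ring_def by auto
  then have fin: "finite A" and "card A \<le> p - 1"
    using finite_subset card_mono[of "{1..int p - 1}" A] by auto
  have "\<exists>a. ordering_of k a A \<and> distinct_partial_sums Zp k a"
  proof (cases k)
    case 0
    then have "A = {}" using fin assms(4) by simp
    then show ?thesis using 0 by (auto simp: ordering_of_def distinct_partial_sums_def bij_betw_def)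
  next
    case (Suc n)
    \<comment> \<open>\<open>A\<close> lies among the \<open>p - 1\<close> nonzero residues, so
      \<open>k < p\<close>.\<close>
    then have "Suc n < p" "n \<le> 9"
      using \<open>card A \<le> p - 1\<close> assms(4,5) prime_gt_1_nat[OF assms(2)] by linarith+
    then show ?thesis
      using exists_two_sided_coeff[OF assms(2), of n] exists_ordering[OF assms(2), of A n]
        assms(3,4) Suc unfolding Zp_def by blast
  qed
  then show ?thesis by blast
qed

end
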